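(* Let $n\ge1$. The space $U_{2n,1}$ is a free $R_{2n}$-module of rank $2n$ with basis $\{v^{(2n)}_r,w^{(2n)}_r\mid 1\le r\le n\}$: $$U_{2n,1}=\bigoplus_{r=1}^nR_{2n}v^{(2n)}_r\ \oplus\ \bigoplus_{r=1}^nR_{2n}w^{(2n)}_r.$$
   Context: $R_{2n}$ is the ring of symmetric polynomials in $x_1,\dots,x_{2n}$ over $\mathbb C$; $H^{(2n)}=\bigoplus_{k=0}^{2n-1}R_{2n}X^k$. $U_{2n,1}$ is the $R_{2n}$-submodule of all $P(X|x_1,\dots,x_{2n})\in H^{(2n)}$ such that $P(x^{-1}|x_1,\dots,x_{2n-2},x,-x)=0$ and $P(-x^{-1}|x_1,\dots,x_{2n-2},x,-x)=0$ identically. $e_k^{(2n)}$ is the $k$-th elementary symmetric polynomial in $x_1,\dots,x_{2n}$, with $e^{(2n)}_k=0$ for $k<0$ or $k>2n$. For $1\le r\le n$, $s\in\mathbb Z$ define recursively $P^{(2n)}_{1,s}=e^{(2n)}_{2s-1}$ and $P^{(2n)}_{r,s}=P^{(2n)}_{r-1,s+1}-e^{(2n)}_{2s}P^{(2n)}_{r-1,1}$ for $r\ge2$. Put $v^{(2n)}_r=\sum_{s=1}^nP^{(2n)}_{r,s}X^{2(s-1)}$ and $w^{(2n)}_r=Xv^{(2n)}_r$. *)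

theory Defs
  imports
    "HOL-Library.Poly_Mapping"
    "HOL-Combinatorics.Permutations"
    "HOL-Computational_Algebra.Polynomial"
    "HOL-Computational_Algebra.Fraction_Field"
begin

text \<open>
  Polynomials over the complex numbers in indeterminates indexed by \<open>nat\<close>: a monomial is its
  finitely supported exponent vector. The paper's $x_1, \dots, x_N$ are \<open>Var 1, \<dots>, Var N\<close>;
  \<open>Var 0\<close> serves as the extra indeterminate $x$.
\<close>

type_synonym cpoly = "(nat \<Rightarrow>\<^sub>0 nat) \<Rightarrow>\<^sub>0 complex"

definition Var :: "nat \<Rightarrow> cpoly" where
  "Var i = Poly_Mapping.single (Poly_Mapping.single i 1) 1"

definition Const :: "complex \<Rightarrow> cpoly" where
  "Const c = Poly_Mapping.single 0 c"

definition vars :: "cpoly \<Rightarrow> nat set" where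
  "vars p = (\<Union>m\<in>Poly_Mapping.keys p. Poly_Mapping.keys m)"

definition subst :: "(nat \<Rightarrow> cpoly) \<Rightarrow> cpoly \<Rightarrow> cpoly" where
  "subst \<sigma> p = (\<Sum>m\<in>Poly_Mapping.keys p.
     Const (Poly_Mapping.lookup p m) *
       (\<Prod>i\<in>Poly_Mapping.keys m. \<sigma> i ^ Poly_Mapping.lookup m i))"

definition sym_polys :: "nat \<Rightarrow> cpoly set" where
  "sym_polys N = {p. vars p \<subseteq> {1..N} \<and>
     (\<forall>\<pi>. \<pi> permutes {1..N} \<longrightarrow> subst (\<lambda>i. Var (\<pi> i)) p = p)}"

text \<open>For an index $k < 0$ or $k > N$ the sum is empty.\<close>

definition elem_sym :: "nat \<Rightarrow> int \<Rightarrow> cpoly" where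
  "elem_sym N k = (\<Sum>A | A \<subseteq> {1..N} \<and> int (card A) = k. \<Prod>i\<in>A. Var i)"

definition H_space :: "nat \<Rightarrow> cpoly poly set" where
  "H_space N = {P. (\<forall>k<N. coeff P k \<in> sym_polys N) \<and> (\<forall>k\<ge>N. coeff P k = 0)}"

text \<open>
  \<open>specialize n P t\<close> is $P(t \mid x_1, \dots, x_{2n-2}, x, -x)$, where $t$ lies in the field of
  rational functions, so that $t = \pm x^{-1}$ is allowed.
\<close>

definition to_fract :: "cpoly \<Rightarrow> cpoly fract" where
  "to_fract p = Fract p 1"

definition spec_subst :: "nat \<Rightarrow> nat \<Rightarrow> cpoly" where
  "spec_subst n i =
     (if i = 2 * n - 1 then Var 0 else if i = 2 * n then - Var 0 else Var i)"

definition specialize :: "nat \<Rightarrow> cpoly poly \<Rightarrow> cpoly fract \<Rightarrow> cpoly fract" where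
  "specialize n P t = poly (map_poly (\<lambda>p. to_fract (subst (spec_subst n) p)) P) t"

definition U_space :: "nat \<Rightarrow> cpoly poly set" where
  "U_space n = {P \<in> H_space (2 * n).
     specialize n P (inverse (to_fract (Var 0))) = 0 \<and>
     specialize n P (- inverse (to_fract (Var 0))) = 0}"

text \<open>The value at \<open>r = 0\<close> is a dummy.\<close>

fun P_sym :: "nat \<Rightarrow> nat \<Rightarrow> int \<Rightarrow> cpoly" where
  "P_sym n 0 s = 0"
| "P_sym n (Suc 0) s = elem_sym (2 * n) (2 * s - 1)"
| "P_sym n (Suc (Suc r)) s =
     P_sym n (Suc r) (s + 1) - elem_sym (2 * n) (2 * s) * P_sym n (Suc r) 1"

definition v_vec :: "nat \<Rightarrow> nat \<Rightarrow> cpoly poly" where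
  "v_vec n r = (\<Sum>s=1..n. monom (P_sym n r (int s)) (2 * (s - 1)))"

definition w_vec :: "nat \<Rightarrow> nat \<Rightarrow> cpoly poly" where
  "w_vec n r = monom 1 1 * v_vec n r"

text \<open>
  Modules over a subring \<open>S\<close> of \<open>'a\<close>, contained in \<open>'a poly\<close>; scalars act by \<open>smult\<close>.
\<close>

definition is_submodule :: "'a::comm_ring_1 set \<Rightarrow> 'a poly set \<Rightarrow> bool" where
  "is_submodule S M \<longleftrightarrow>
     0 \<in> M \<and> (\<forall>x\<in>M. \<forall>y\<in>M. x + y \<in> M) \<and> (\<forall>a\<in>S. \<forall>x\<in>M. smult a x \<in> M)"

definition span_over :: "'a::comm_ring_1 set \<Rightarrow> 'a poly set \<Rightarrow> 'a poly set" where
  "span_over S B = {(\<Sum>b\<in>A. smult (c b) b) | A c. finite A \<and> A \<subseteq> B \<and> c ` A \<subseteq> S}"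

definition independent_over :: "'a::comm_ring_1 set \<Rightarrow> 'a poly set \<Rightarrow> bool" where
  "independent_over S B \<longleftrightarrow>
     (\<forall>A c. finite A \<and> A \<subseteq> B \<and> c ` A \<subseteq> S \<and> (\<Sum>b\<in>A. smult (c b) b) = 0
        \<longrightarrow> (\<forall>b\<in>A. c b = 0))"

definition is_free_basis :: "'a::comm_ring_1 set \<Rightarrow> 'a poly set \<Rightarrow> 'a poly set \<Rightarrow> bool" where
  "is_free_basis S M B \<longleftrightarrow>
     is_submodule S M \<and> B \<subseteq> M \<and> span_over S B = M \<and> independent_over S B"

definition cyclic_submodule :: "'a::comm_ring_1 set \<Rightarrow> 'a poly \<Rightarrow> 'a poly set" where
  "cyclic_submodule S b = {smult a b | a. a \<in> S}"

definition is_direct_sum :: "'a::comm_monoid_add set \<Rightarrow> 'i set \<Rightarrow> ('i \<Rightarrow> 'a set) \<Rightarrow> bool" where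
  "is_direct_sum M I N \<longleftrightarrow>
     M = {(\<Sum>i\<in>I. f i) | f. \<forall>i\<in>I. f i \<in> N i} \<and>
     (\<forall>f g. (\<forall>i\<in>I. f i \<in> N i \<and> g i \<in> N i) \<and> (\<Sum>i\<in>I. f i) = (\<Sum>i\<in>I. g i)
        \<longrightarrow> (\<forall>i\<in>I. f i = g i))"

end

theory Submission
  imports Defs "Jordan_Normal_Form.Char_Poly"
begin

text \<open>
  Splitting \<open>P\<close> into its even and odd part in \<open>X\<close>, the two conditions defining \<open>U\<^bsub>2n,1\<^esub>\<close> decouple:
  each part is a coefficient vector \<open>(a\<^sub>1, \<dots>, a\<^sub>n)\<close> over \<open>R\<^bsub>2n\<^esub>\<close> with
  \<open>\<Sum>\<^sub>s \<phi>(a\<^sub>s) x\<^bsup>2(n-s)\<^esup> = 0\<close>, where \<open>\<phi>\<close> substitutes \<open>x\<close> and \<open>-x\<close> for the last two variables. The rows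
  of the matrix \<open>(P\<^bsub>r,s\<^esub>)\<close> satisfy this relation because
  \<open>\<phi>(e\<^sub>k\<^bsup>(2n)\<^esup>) = e\<^sub>k\<^bsup>(2n-2)\<^esup> - x\<^sup>2 e\<^bsub>k-2\<^esub>\<^bsup>(2n-2)\<^esup>\<close> makes the sums telescope. Any \<open>n \<times> n\<close> matrix of such
  vectors has a determinant killed by \<open>\<phi>\<close>; being symmetric, it is divisible by
  \<open>\<Delta> = \<Prod>\<^bsub>i<j\<^esub> (x\<^sub>i + x\<^sub>j)\<close>. The determinant of \<open>(P\<^bsub>r,s\<^esub>)\<close> is nonzero and homogeneous of the same
  degree \<open>n(2n-1)\<close> as \<open>\<Delta>\<close>, hence a nonzero constant multiple of it. So Cramer's rule expresses
  every solution in terms of the rows with coefficients in \<open>R\<^bsub>2n\<^esub>\<close>, uniquely.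
\<close>

section \<open>Substitution homomorphisms and symmetric polynomials\<close>

lemma Const_hom:
  "Const 0 = 0" "Const 1 = 1" "Const (a + b) = Const a + Const b" "Const (a * b) = Const a * Const b"
  by (simp_all add: Const_def single_add mult_single)

lemma Const_eq_0_iff: "Const c = 0 \<longleftrightarrow> c = 0"
proof
  assume "Const c = 0"
  hence "Poly_Mapping.lookup (Const c) 0 = 0" by simp
  thus "c = 0" by (simp add: Const_def)
qed (simp add: Const_hom)

interpretation Const: comm_ring_hom Const
  by unfold_locales (simp_all add: Const_hom)

text \<open>Both sides are extended to the union of the two supports, where the extra factors are
  zeroth powers; this is the multiplicativity of substitution on monomials.\<close>

lemma keys_prod_add:
  "(\<Prod>i\<in>Poly_Mapping.keys (m + m'). f i ^ Poly_Mapping.lookup (m + m') i) =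
   (\<Prod>i\<in>Poly_Mapping.keys m. f i ^ Poly_Mapping.lookup m i) *
   (\<Prod>i\<in>Poly_Mapping.keys m'. (f i :: cpoly) ^ Poly_Mapping.lookup m' i)"
proof -
  let ?K = "Poly_Mapping.keys m \<union> Poly_Mapping.keys m'"
  have *: "(\<Prod>i\<in>Poly_Mapping.keys k. f i ^ Poly_Mapping.lookup k i) =
           (\<Prod>i\<in>?K. f i ^ Poly_Mapping.lookup k i)" if "Poly_Mapping.keys k \<subseteq> ?K" for k
    using that by (intro prod.mono_neutral_left) (auto simp: in_keys_iff)
  show ?thesis
    by (subst (1 2 3) *) (auto simp: keys_add lookup_add power_add prod.distrib dest: subsetD[OF keys_add])
qed

lemma sum_singles:
  "p = (\<Sum>m\<in>Poly_Mapping.keys p. Poly_Mapping.single m (Poly_Mapping.lookup p m))"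
  by (rule poly_mapping_eqI)
    (auto simp: lookup_sum lookup_single when_def in_keys_iff sum.delta')

lemma prod_Var:
  "(\<Prod>i\<in>Poly_Mapping.keys m. Var i ^ Poly_Mapping.lookup m i) = Poly_Mapping.single m 1"
proof -
  have pow: "Var i ^ k = Poly_Mapping.single (Poly_Mapping.single i k) 1" for i k
    by (induction k) (simp_all add: Var_def mult_single flip: single_add)
  have "(\<Prod>i\<in>K. Poly_Mapping.single (h i) (1::complex)) = Poly_Mapping.single (\<Sum>i\<in>K. h i) 1"
    if "finite K" for K and h :: "nat \<Rightarrow> nat \<Rightarrow>\<^sub>0 nat"
    using that by induction (simp_all add: mult_single)
  thus ?thesis by (simp add: pow flip: sum_singles)
qed

lemma single_eq_Const_mult_Var:
  "Poly_Mapping.single m c = Const c * (\<Prod>i\<in>Poly_Mapping.keys m. Var i ^ Poly_Mapping.lookup m i)"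
  by (simp add: prod_Var Const_def mult_single)

lemma subst_superset:
  assumes "finite K" "Poly_Mapping.keys p \<subseteq> K"
  shows "subst \<sigma> p = (\<Sum>m\<in>K. Const (Poly_Mapping.lookup p m) *
           (\<Prod>i\<in>Poly_Mapping.keys m. \<sigma> i ^ Poly_Mapping.lookup m i))"
  unfolding subst_def using assms by (intro sum.mono_neutral_left) (auto simp: in_keys_iff Const_hom)

lemma subst_single:
  "subst \<sigma> (Poly_Mapping.single m c) =
     Const c * (\<Prod>i\<in>Poly_Mapping.keys m. \<sigma> i ^ Poly_Mapping.lookup m i)"
  by (subst subst_superset[of "{m}"]) auto

lemma subst_Const: "subst \<sigma> (Const c) = Const c"
  by (simp add: Const_def[of c] subst_single)

lemma subst_Var: "subst \<sigma> (Var i) = \<sigma> i"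
  by (simp add: Var_def subst_single Const_hom)

lemma subst_add: "subst \<sigma> (p + q) = subst \<sigma> p + subst \<sigma> q"
  by (subst (1 2 3) subst_superset[of "Poly_Mapping.keys p \<union> Poly_Mapping.keys q"])
    (auto simp: lookup_add Const_hom algebra_simps sum.distrib dest: subsetD[OF keys_add])

lemma subst_zero: "subst \<sigma> 0 = 0"
  by (simp add: subst_def)

lemma subst_sum: "subst \<sigma> (\<Sum>i\<in>I. f i) = (\<Sum>i\<in>I. subst \<sigma> (f i))"
  by (induction I rule: infinite_finite_induct) (simp_all add: subst_add subst_zero)

lemma subst_mult: "subst \<sigma> (p * q) = subst \<sigma> p * subst \<sigma> q"
proof -
  have "p * q = (\<Sum>m\<in>Poly_Mapping.keys p. \<Sum>m'\<in>Poly_Mapping.keys q.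
      Poly_Mapping.single (m + m') (Poly_Mapping.lookup p m * Poly_Mapping.lookup q m'))"
    by (subst (1) sum_singles[of p], subst (1) sum_singles[of q])
      (simp add: sum_product mult_single)
  also have "subst \<sigma> \<dots> = subst \<sigma> p * subst \<sigma> q"
    unfolding subst_def[of \<sigma> p] subst_def[of \<sigma> q]
    by (simp add: subst_sum subst_single keys_prod_add sum_product Const_hom mult_ac)
  finally show ?thesis .
qed

interpretation subst: comm_ring_hom "subst \<sigma>" for \<sigma>
  using subst_Const[of \<sigma> 1] by unfold_locales (simp_all add: subst_add subst_mult subst_zero Const_hom)

text \<open>Constants and variables generate the polynomial ring, so identities between
  substitutions need checking only on generators.\<close>

lemma cpoly_induct [case_names Const Var add mult]:
  assumes "\<And>c. P (Const c)" "\<And>i. P (Var i)"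
    and "\<And>p q. P p \<Longrightarrow> P q \<Longrightarrow> P (p + q)" "\<And>p q. P p \<Longrightarrow> P q \<Longrightarrow> P (p * q)"
  shows "P p"
proof -
  have P0: "P 0" and P1: "P 1" using assms(1)[of 0] assms(1)[of 1] by (simp_all add: Const_hom)
  have sum: "P (sum f A)" if "\<And>a. a \<in> A \<Longrightarrow> P (f a)" for A and f :: "(nat \<Rightarrow>\<^sub>0 nat) \<Rightarrow> cpoly"
    using that by (induction A rule: infinite_finite_induct) (auto intro: P0 assms(3))
  have prod: "P (prod f A)" if "\<And>a. a \<in> A \<Longrightarrow> P (f a)" for A and f :: "nat \<Rightarrow> cpoly"
    using that by (induction A rule: infinite_finite_induct) (auto intro: P1 assms(4))
  have "P (Var i ^ k)" for i k
    by (induction k) (auto intro: P1 assms(2,4))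
  hence "P (Poly_Mapping.single m c)" for m c
    unfolding single_eq_Const_mult_Var by (intro assms(1,4) prod)
  hence "P (\<Sum>m\<in>Poly_Mapping.keys p. Poly_Mapping.single m (Poly_Mapping.lookup p m))"
    by (intro sum)
  thus ?thesis by (simp flip: sum_singles)
qed

lemma subst_comp: "subst \<sigma> (subst \<tau> p) = subst (\<lambda>i. subst \<sigma> (\<tau> i)) p"
  by (induction p rule: cpoly_induct) (simp_all add: subst_Const subst_Var subst_add subst_mult)

lemma subst_Var_id: "subst Var p = p"
  by (induction p rule: cpoly_induct) (simp_all add: subst_Const subst_Var subst_add subst_mult)

lemma subst_cong: "(\<And>i. i \<in> vars p \<Longrightarrow> \<sigma> i = \<tau> i) \<Longrightarrow> subst \<sigma> p = subst \<tau> p"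
  unfolding subst_def vars_def
  by (intro sum.cong refl arg_cong2[of _ _ _ _ "(*)"] prod.cong arg_cong2[of _ _ _ _ "(^)"]) auto

text \<open>The endomorphism killing the variables outside \<open>S\<close> maps each monomial to
  itself or to 0. As a fixed-point equation the condition on variables fits the permutation
  conditions, and \<open>sym_polys\<close> becomes an intersection of fixed rings.\<close>

lemma vars_subset_iff: "vars p \<subseteq> S \<longleftrightarrow> subst (\<lambda>i. if i \<in> S then Var i else 0) p = p"
proof
  assume "vars p \<subseteq> S"
  hence "subst (\<lambda>i. if i \<in> S then Var i else 0) p = subst Var p"
    by (intro subst_cong) auto
  thus "subst (\<lambda>i. if i \<in> S then Var i else 0) p = p" by (simp add: subst_Var_id)
next
  let ?\<sigma> = "\<lambda>i. if i \<in> S then Var i else 0"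
  assume fixed: "subst ?\<sigma> p = p"
  have "Poly_Mapping.keys m \<subseteq> S" if m: "m \<in> Poly_Mapping.keys p" for m
  proof (rule ccontr)
    assume "\<not> Poly_Mapping.keys m \<subseteq> S"
    then obtain i where i: "i \<in> Poly_Mapping.keys m" "i \<notin> S" by blast
    \<comment> \<open>A monomial \<open>k\<close> over \<open>S\<close> stays \<open>k\<close>,
      which differs from \<open>m\<close>; any other one is sent to 0.\<close>
    have "Poly_Mapping.lookup (Const c * (\<Prod>i\<in>Poly_Mapping.keys k. ?\<sigma> i ^ Poly_Mapping.lookup k i)) m = 0"
      for k c
    proof (cases "Poly_Mapping.keys k \<subseteq> S")
      case True
      hence "(\<Prod>i\<in>Poly_Mapping.keys k. ?\<sigma> i ^ Poly_Mapping.lookup k i) = Poly_Mapping.single k 1"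
        unfolding prod_Var[symmetric] by (intro prod.cong) auto
      moreover have "k \<noteq> m" using True i by auto
      ultimately show ?thesis by (simp add: Const_def mult_single lookup_single_not_eq)
    next
      case False
      then obtain j where "j \<in> Poly_Mapping.keys k" "j \<notin> S" by blast
      hence "(\<Prod>i\<in>Poly_Mapping.keys k. ?\<sigma> i ^ Poly_Mapping.lookup k i) = 0"
        by (intro prod_zero) (auto intro!: bexI[of _ j] simp: in_keys_iff)
      thus ?thesis by (simp only: mult_zero_right lookup_zero)
    qed
    hence "Poly_Mapping.lookup (subst ?\<sigma> p) m = 0"
      unfolding subst_def lookup_sum by simp
    with fixed m show False by (simp add: in_keys_iff)
  qed
  thus "vars p \<subseteq> S" by (auto simp: vars_def)
qed

lemma sym_polys_iff:
  "p \<in> sym_polys N \<longleftrightarrow> subst (\<lambda>i. if i \<in> {1..N} then Var i else 0) p = p \<and>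
     (\<forall>\<pi>. \<pi> permutes {1..N} \<longrightarrow> subst (\<lambda>i. Var (\<pi> i)) p = p)"
  unfolding sym_polys_def vars_subset_iff by simp

definition is_subring :: "'a::comm_ring_1 set \<Rightarrow> bool" where
  "is_subring S \<longleftrightarrow> 0 \<in> S \<and> 1 \<in> S \<and> (\<forall>x\<in>S. \<forall>y\<in>S. x + y \<in> S \<and> x - y \<in> S \<and> x * y \<in> S)"

lemma is_subring_sym_polys: "is_subring (sym_polys N)"
  by (auto simp: is_subring_def sym_polys_iff subst_add subst_mult subst.hom_minus)

lemma Const_in_sym_polys: "Const c \<in> sym_polys N"
  by (simp add: sym_polys_iff subst_Const)

lemma is_subring_closed:
  assumes "is_subring S"
  shows "(\<And>i. i \<in> I \<Longrightarrow> f i \<in> S) \<Longrightarrow> sum f I \<in> S"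
    and "(\<And>i. i \<in> I \<Longrightarrow> f i \<in> S) \<Longrightarrow> prod f I \<in> S"
  using assms unfolding is_subring_def
  by (induction I rule: infinite_finite_induct) simp_all

section \<open>Elementary symmetric polynomials under the specialization\<close>

text \<open>Generalizes \<open>elem_sym\<close> to arbitrary values and index sets, so that it
  covers substituted variables, recursion on the index set, and complex roots.\<close>

definition esym :: "(nat \<Rightarrow> 'a::comm_ring_1) \<Rightarrow> nat set \<Rightarrow> int \<Rightarrow> 'a" where
  "esym f S k = (\<Sum>A | A \<subseteq> S \<and> int (card A) = k. \<Prod>i\<in>A. f i)"

lemma elem_sym_eq_esym: "elem_sym N k = esym Var {1..N} k"
  by (simp add: elem_sym_def esym_def)

text \<open>The subsets are split according to whether they contain \<open>a\<close>.\<close>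

lemma esym_insert:
  assumes "finite S" "a \<notin> S"
  shows "esym f (insert a S) k = esym f S k + f a * esym f S (k - 1)"
proof -
  have split: "{A. A \<subseteq> insert a S \<and> int (card A) = k} =
      {A. A \<subseteq> S \<and> int (card A) = k} \<union> insert a ` {A. A \<subseteq> S \<and> int (card A) = k - 1}"
    (is "?L = ?A \<union> insert a ` ?B")
  proof (intro equalityI subsetI)
    fix A assume A: "A \<in> ?L"
    show "A \<in> ?A \<union> insert a ` ?B"
    proof (cases "a \<in> A")
      case True
      have "finite A" using A assms(1) by (auto intro: finite_subset)
      hence "card A = Suc (card (A - {a}))" using True by (rule card.remove)
      hence "int (card (A - {a})) = k - 1" using A by (simp only: mem_Collect_eq) linarith
      hence "A - {a} \<in> ?B" using A by blast
      moreover have "A = insert a (A - {a})" using True by blast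
      ultimately show ?thesis by blast
    qed (use A in auto)
  next
    fix A assume "A \<in> ?A \<union> insert a ` ?B"
    thus "A \<in> ?L"
    proof
      assume "A \<in> insert a ` ?B"
      then obtain B where B: "A = insert a B" "B \<subseteq> S" "int (card B) = k - 1" by blast
      moreover have "finite B" "a \<notin> B" using B assms by (auto intro: finite_subset)
      ultimately show ?thesis by auto
    qed auto
  qed
  have fin: "finite ?A" "finite ?B" using assms(1) by auto
  have inj: "inj_on (insert a) ?B" using assms(2) by (intro inj_onI) (auto simp: insert_ident)
  have "esym f (insert a S) k = (\<Sum>A\<in>?A. \<Prod>i\<in>A. f i) + (\<Sum>A\<in>insert a ` ?B. \<Prod>i\<in>A. f i)"
    unfolding esym_def split using fin assms(2) by (intro sum.union_disjoint) auto
  also have "(\<Sum>A\<in>insert a ` ?B. \<Prod>i\<in>A. f i) = (\<Sum>A\<in>?B. f a * (\<Prod>i\<in>A. f i))"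
    unfolding sum.reindex[OF inj] using assms
    by (intro sum.cong) (auto intro!: prod.insert intro: finite_subset)
  finally show ?thesis by (simp add: esym_def sum_distrib_left)
qed

lemma esym_negative: "k < 0 \<Longrightarrow> esym f S k = 0"
  by (simp add: esym_def)

lemma esym_gt_card:
  assumes "finite S" "int (card S) < k"
  shows "esym f S k = 0"
proof -
  have "int (card A) \<noteq> k" if "A \<subseteq> S" for A
    using card_mono[OF assms(1) that] assms(2) by linarith
  hence "{A. A \<subseteq> S \<and> int (card A) = k} = {}" by blast
  thus ?thesis by (simp only: esym_def sum.empty)
qed

lemma esym_0:
  assumes "finite S"
  shows "esym f S 0 = 1"
proof -
  have "{A. A \<subseteq> S \<and> int (card A) = 0} = {{}}"
    using assms by (auto dest: finite_subset)
  thus ?thesis by (simp add: esym_def)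
qed

lemma esym_cong: "(\<And>i. i \<in> S \<Longrightarrow> f i = g i) \<Longrightarrow> esym f S k = esym g S k"
  unfolding esym_def by (intro sum.cong prod.cong) auto

text \<open>Permuting the variables permutes the index subsets of a given size; this gives the
  symmetry of both \<open>elem_sym\<close> and \<open>pair_sums\<close>.\<close>

lemma bij_betw_image_card:
  assumes "inj_on h S"
  shows "bij_betw ((`) h) {A. A \<subseteq> S \<and> Q (card A)} {A. A \<subseteq> h ` S \<and> Q (card A)}"
proof -
  have "inj_on h A" if "A \<subseteq> S" for A using assms that by (rule inj_on_subset)
  thus ?thesis by (intro bij_betw_imageI inj_onI)
    (auto simp: card_image image_iff subset_image_iff inj_on_image_eq_iff[OF assms])
qed

lemma esym_reindex:
  assumes "inj_on h S"
  shows "esym (\<lambda>i. f (h i)) S k = esym f (h ` S) k"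
proof -
  have inj: "inj_on h A" if "A \<subseteq> S" for A using assms that by (rule inj_on_subset)
  from sum.reindex_bij_betw[OF bij_betw_image_card[OF assms, of "\<lambda>c. int c = k"], of "prod f"]
  show ?thesis
    unfolding esym_def by (simp add: prod.reindex[OF inj] cong: sum.cong_simp)
qed

lemma (in comm_ring_hom) hom_esym: "hom (esym f S k) = esym (\<lambda>i. hom (f i)) S k"
  by (simp add: esym_def hom_sum hom_prod)

lemma elem_sym_in_sym_polys: "elem_sym N k \<in> sym_polys N"
  unfolding sym_polys_iff
proof (intro conjI allI impI)
  show "subst (\<lambda>i. if i \<in> {1..N} then Var i else 0) (elem_sym N k) = elem_sym N k"
    by (auto simp: elem_sym_eq_esym subst.hom_esym subst_Var intro!: esym_cong)
  fix \<pi> assume \<pi>: "\<pi> permutes {1..N}"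
  show "subst (\<lambda>i. Var (\<pi> i)) (elem_sym N k) = elem_sym N k"
    by (simp add: elem_sym_eq_esym subst.hom_esym subst_Var esym_reindex[OF permutes_inj_on[OF \<pi>], where f = Var]
        permutes_image[OF \<pi>] del: One_nat_def)
qed

lemma P_sym_in_sym_polys: "P_sym n r s \<in> sym_polys (2 * n)"
proof (induction n r s rule: P_sym.induct)
  case (1 n s)
  show ?case using is_subring_sym_polys by (simp add: is_subring_def)
next
  case (3 n r s)
  thus ?case using is_subring_sym_polys[of "2 * n"] by (simp add: is_subring_def elem_sym_in_sym_polys)
qed (simp add: elem_sym_in_sym_polys)

lemma elem_sym_gt: "int N < k \<Longrightarrow> elem_sym N k = 0"
  by (simp add: elem_sym_eq_esym esym_gt_card)

text \<open>The recursion only raises \<open>s\<close>, and every elementary symmetric polynomial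
  that it multiplies by has index above \<open>2 * n\<close>.\<close>

lemma P_sym_gt: "int n < s \<Longrightarrow> P_sym n r s = 0"
  by (induction n r s rule: P_sym.induct) (simp_all add: elem_sym_gt)

text \<open>In generating functions, the last two variables contribute
  \<open>(1 + x t) (1 - x t) = 1 - x^2 t^2\<close>.\<close>

lemma spec_elem_sym:
  assumes "n \<ge> 1"
  shows "subst (spec_subst n) (elem_sym (2 * n) k) =
         elem_sym (2 * n - 2) k - Var 0 ^ 2 * elem_sym (2 * n - 2) (k - 2)"
proof -
  let ?S = "{1..2 * n - 2}" and ?f = "spec_subst n"
  have ins: "{1..2 * n} = insert (2 * n) (insert (2 * n - 1) ?S)" using assms by auto
  have E: "esym ?f ?S j = elem_sym (2 * n - 2) j" for j
    unfolding elem_sym_eq_esym by (intro esym_cong) (auto simp: spec_subst_def)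
  have fin1: "finite (insert (2 * n - 1) ?S)" and fin2: "finite ?S" by simp_all
  have notin1: "2 * n \<notin> insert (2 * n - 1) ?S" and notin2: "2 * n - 1 \<notin> ?S" using assms by auto
  have f: "?f (2 * n) = - Var 0" "?f (2 * n - 1) = Var 0"
    using assms by (auto simp: spec_subst_def)
  have "subst ?f (elem_sym (2 * n) k) = esym ?f (insert (2 * n) (insert (2 * n - 1) ?S)) k"
    unfolding elem_sym_eq_esym subst.hom_esym subst_Var ins ..
  also have "\<dots> = esym ?f ?S k - Var 0 ^ 2 * esym ?f ?S (k - 2)"
    using assms by (simp only: esym_insert[OF fin1 notin1] esym_insert[OF fin2 notin2] f)
      (simp add: algebra_simps power2_eq_square)
  finally show ?thesis unfolding E .
qed

text \<open>For the even-indexed (odd-indexed) coefficients \<open>a\<close> of \<open>P\<close>, the sum is \<open>x\<^bsup>2n-2\<^esup>\<close>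
  (\<open>x\<^bsup>2n-1\<^esup>\<close>) times the even (odd) part of \<open>P(x\<^sup>-\<^sup>1 | x\<^sub>1, \<dots>, x, -x)\<close>.\<close>

definition spec_sum :: "nat \<Rightarrow> (nat \<Rightarrow> cpoly) \<Rightarrow> cpoly" where
  "spec_sum n a = (\<Sum>s<n. subst (spec_subst n) (a s) * Var 0 ^ (2 * (n - 1 - s)))"

text \<open>By \<open>spec_elem_sym\<close> the sum telescopes. The offset \<open>c = -1\<close>
  gives the first row of the recursion, \<open>c = 0\<close> its correction term.\<close>

lemma spec_sum_elem_sym:
  assumes "n \<ge> 1"
  shows "spec_sum n (\<lambda>s. elem_sym (2 * n) (2 * int s + 2 + c)) =
         elem_sym (2 * n - 2) (2 * int n + c) - elem_sym (2 * n - 2) c * Var 0 ^ (2 * n)"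
proof -
  let ?f = "\<lambda>s. elem_sym (2 * n - 2) (2 * int s + c) * Var 0 ^ (2 * (n - s))"
  have "spec_sum n (\<lambda>s. elem_sym (2 * n) (2 * int s + 2 + c)) = (\<Sum>s<n. ?f (Suc s) - ?f s)"
    unfolding spec_sum_def
  proof (intro sum.cong refl)
    fix s assume "s \<in> {..<n}"
    hence e: "2 * (n - s) = Suc (Suc (2 * (n - 1 - s)))" by auto
    show "subst (spec_subst n) (elem_sym (2 * n) (2 * int s + 2 + c)) * Var 0 ^ (2 * (n - 1 - s)) =
        ?f (Suc s) - ?f s"
      unfolding spec_elem_sym[OF assms] e by (simp add: algebra_simps power2_eq_square)
  qed
  also have "\<dots> = ?f n - ?f 0" by (rule sum_lessThan_telescope)
  finally show ?thesis by simp
qed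

text \<open>Shifting row \<open>r\<close> by one multiplies its relation by \<open>x^2\<close> and
  drops the first term, leaving minus the image of \<open>P_sym n r 1\<close> times
  \<open>x^(2n)\<close>. The correction term contributes the same with the opposite sign.\<close>

lemma spec_sum_P_sym:
  assumes "n \<ge> 1"
  shows "spec_sum n (\<lambda>s. P_sym n r (int s + 1)) = 0"
proof (induction r)
  case 0
  show ?case by (simp add: spec_sum_def)
next
  case (Suc r)
  show ?case
  proof (cases r)
    case 0
    have "spec_sum n (\<lambda>s. P_sym n (Suc r) (int s + 1)) =
        spec_sum n (\<lambda>s. elem_sym (2 * n) (2 * int s + 2 + - 1))"
      by (simp add: 0 algebra_simps)
    also have "\<dots> = 0"
      unfolding spec_sum_elem_sym[OF assms] using assms
      by (simp add: elem_sym_eq_esym esym_negative esym_gt_card)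
    finally show ?thesis .
  next
    case (Suc r')
    let ?\<phi> = "subst (spec_subst n)" and ?p = "P_sym n r"
    let ?h = "\<lambda>s. ?\<phi> (?p (int s + 1)) * Var 0 ^ (2 * (n - s))"
    have "(\<Sum>s<n. ?h s) = Var 0 ^ 2 * spec_sum n (\<lambda>s. ?p (int s + 1))"
      unfolding spec_sum_def sum_distrib_left
    proof (intro sum.cong refl)
      fix s assume "s \<in> {..<n}"
      hence e: "2 * (n - s) = Suc (Suc (2 * (n - 1 - s)))" by auto
      show "?h s = Var 0 ^ 2 * (?\<phi> (?p (int s + 1)) * Var 0 ^ (2 * (n - 1 - s)))"
        unfolding e by (simp add: algebra_simps power2_eq_square)
    qed
    hence h: "(\<Sum>s<n. ?h s) = 0" by (simp add: Suc.IH)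
    have "(\<Sum>s<Suc n. ?h s) = ?h 0 + (\<Sum>s<n. ?h (Suc s))" by (rule sum.lessThan_Suc_shift)
    \<comment> \<open>The shift moves in an entry beyond position \<open>n\<close>, which is
      0.\<close>
    moreover have "?h n = 0" by (simp add: P_sym_gt)
    ultimately have "?h 0 + (\<Sum>s<n. ?h (Suc s)) = 0" using h by simp
    moreover have "spec_sum n (\<lambda>s. P_sym n (Suc r) (int s + 1)) =
        (\<Sum>s<n. ?h (Suc s)) - ?\<phi> (?p 1) * spec_sum n (\<lambda>s. elem_sym (2 * n) (2 * int s + 2 + 0))"
      unfolding spec_sum_def sum_distrib_left sum_subtractf[symmetric] \<open>r = Suc r'\<close> P_sym.simps
      by (intro sum.cong refl) (simp add: subst.hom_minus subst_mult algebra_simps)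
    moreover have "spec_sum n (\<lambda>s. elem_sym (2 * n) (2 * int s + 2 + 0)) = - (Var 0 ^ (2 * n))"
      unfolding spec_sum_elem_sym[OF assms] using assms
      by (simp add: elem_sym_eq_esym esym_0 esym_gt_card)
    ultimately show ?thesis by (simp add: algebra_simps)
  qed
qed

section \<open>Decoupling of the vanishing conditions into even and odd coefficients\<close>

lemma Var_nonzero: "Var i \<noteq> 0"
proof
  assume "Var i = 0"
  hence "Poly_Mapping.lookup (Var i) (Poly_Mapping.single i 1) = 0" by simp
  thus False by (simp add: Var_def)
qed

interpretation to_fract: comm_ring_hom Defs.to_fract
  by unfold_locales (simp_all add: Defs.to_fract_def Zero_fract_def One_fract_def)

lemma to_fract_eq_0_iff: "Defs.to_fract p = 0 \<longleftrightarrow> p = 0"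
  by (simp add: Defs.to_fract_def Zero_fract_def eq_fract)

lemma sum_even_odd: "(\<Sum>k<2 * (n::nat). g k) = (\<Sum>s<n. g (2 * s) + (g (2 * s + 1) :: 'a::comm_monoid_add))"
  by (induction n) (simp_all add: add_ac)

text \<open>The factor \<open>x^(2n-1)\<close> clears all denominators. Since \<epsilon> squares to
  1, it survives only at odd powers of \<open>X\<close>, so both evaluation points are treated at
  once.\<close>

lemma specialize_eq:
  assumes "n \<ge> 1" "P \<in> H_space (2 * n)" "\<epsilon> = 1 \<or> \<epsilon> = - 1"
  shows "Defs.to_fract (Var 0) ^ (2 * n - 1) *
           specialize n P (Defs.to_fract \<epsilon> * inverse (Defs.to_fract (Var 0))) =
         Defs.to_fract (Var 0 * spec_sum n (\<lambda>s. coeff P (2 * s)) +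
           \<epsilon> * spec_sum n (\<lambda>s. coeff P (2 * s + 1)))"
proof -
  let ?X = "Defs.to_fract (Var 0)" and ?e = "Defs.to_fract \<epsilon>"
  let ?F = "\<lambda>p. Defs.to_fract (subst (spec_subst n) p)"
  let ?t = "?e * inverse ?X"
  have X: "?X \<noteq> 0" by (simp add: to_fract_eq_0_iff Var_nonzero)
  have e: "?e * ?e = 1" using assms(3) by (auto simp: to_fract.hom_uminus)
  have e2: "?e ^ (2 * s) = 1" for s
    by (simp add: power_mult power2_eq_square e)
  have c: "coeff (map_poly ?F P) k = 0" if "k \<ge> 2 * n" for k
    using assms(2) that by (simp add: coeff_map_poly H_space_def)
  have "specialize n P ?t = (\<Sum>k\<le>degree (map_poly ?F P). coeff (map_poly ?F P) k * ?t ^ k)"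
    by (simp add: specialize_def poly_altdef)
  also have "\<dots> = (\<Sum>k<2 * n. coeff (map_poly ?F P) k * ?t ^ k)"
    \<comment> \<open>Substitution may lower the degree, hence the fixed range below
      \<open>2 * n\<close>.\<close>
    by (rule sum.mono_neutral_cong) (auto simp: c coeff_eq_0 not_le not_less)
  also have "\<dots> = (\<Sum>s<n. ?F (coeff P (2 * s)) * ?t ^ (2 * s) + ?F (coeff P (2 * s + 1)) * ?t ^ (2 * s + 1))"
    by (simp add: sum_even_odd coeff_map_poly)
  finally have sp: "specialize n P ?t = \<dots>" .
  show ?thesis
    unfolding sp spec_sum_def sum_distrib_left sum.distrib[symmetric] to_fract.hom_sum
  proof (intro sum.cong refl)
    fix s assume "s \<in> {..<n}"
    hence d: "2 * n - 1 = Suc (2 * (n - 1 - s)) + 2 * s" by auto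
    have Xs: "?X ^ (2 * s) * inverse ?X ^ (2 * s) = 1"
      using X by (simp flip: power_mult_distrib)
    have ts: "?t ^ (2 * s) = inverse ?X ^ (2 * s)"
      by (simp only: power_mult_distrib e2 mult_1)
    have "?X ^ (2 * n - 1) * ?t ^ (2 * s) = ?X * ?X ^ (2 * (n - 1 - s))"
      unfolding d power_add ts using Xs by (simp add: mult_ac)
    moreover have "?X ^ (2 * n - 1) * ?t ^ (2 * s + 1) = ?e * ?X ^ (2 * (n - 1 - s))"
      unfolding d power_add ts power_Suc power_one_right using Xs X
      by (simp add: mult_ac mult.left_commute[of "inverse ?X" ?X])
    ultimately have "?X ^ (2 * n - 1) * (a * ?t ^ (2 * s) + b * ?t ^ (2 * s + 1)) =
        ?X * (a * ?X ^ (2 * (n - 1 - s))) + ?e * (b * ?X ^ (2 * (n - 1 - s)))" for a b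
      by (simp only: distrib_left mult.left_commute[of "?X ^ (2 * n - 1)"])
        (simp only: mult.left_commute)
    thus "?X ^ (2 * n - 1) * (?F (coeff P (2 * s)) * ?t ^ (2 * s) + ?F (coeff P (2 * s + 1)) * ?t ^ (2 * s + 1)) =
       Defs.to_fract (Var 0 * (subst (spec_subst n) (coeff P (2 * s)) * Var 0 ^ (2 * (n - 1 - s))) +
        \<epsilon> * (subst (spec_subst n) (coeff P (2 * s + 1)) * Var 0 ^ (2 * (n - 1 - s))))"
      unfolding to_fract.hom_add to_fract.hom_mult to_fract.hom_power .
  qed
qed

text \<open>With even part \<open>a\<close> and odd part \<open>b\<close>, the conditions read
  \<open>x a + b = 0\<close> and \<open>x a - b = 0\<close>. Their difference is \<open>2 b\<close>,
  and the polynomial ring is a domain of characteristic 0.\<close>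

lemma U_space_iff:
  assumes "n \<ge> 1"
  shows "P \<in> U_space n \<longleftrightarrow> P \<in> H_space (2 * n) \<and>
    spec_sum n (\<lambda>s. coeff P (2 * s)) = 0 \<and> spec_sum n (\<lambda>s. coeff P (2 * s + 1)) = 0"
proof (cases "P \<in> H_space (2 * n)")
  case True
  let ?X = "Defs.to_fract (Var 0)"
  let ?a = "spec_sum n (\<lambda>s. coeff P (2 * s))" and ?b = "spec_sum n (\<lambda>s. coeff P (2 * s + 1))"
  have X: "?X ^ (2 * n - 1) \<noteq> 0" by (simp add: to_fract_eq_0_iff Var_nonzero)
  have zero: "a = 0 \<longleftrightarrow> p = 0" if "?X ^ (2 * n - 1) * a = Defs.to_fract p" for a p
  proof -
    have "a = 0 \<longleftrightarrow> ?X ^ (2 * n - 1) * a = 0" using X by (simp only: mult_eq_0_iff simp_thms)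
    thus ?thesis unfolding that to_fract_eq_0_iff .
  qed
  have sp: "specialize n P (Defs.to_fract \<epsilon> * inverse ?X) = 0 \<longleftrightarrow> Var 0 * ?a + \<epsilon> * ?b = 0"
    if "\<epsilon> = 1 \<or> \<epsilon> = - 1" for \<epsilon>
    by (rule zero[OF specialize_eq[OF assms True that]])
  have "specialize n P (inverse ?X) = 0 \<longleftrightarrow> Var 0 * ?a + ?b = 0"
    using sp[of 1] by (simp only: to_fract.hom_one mult_1 simp_thms)
  moreover have "specialize n P (- inverse ?X) = 0 \<longleftrightarrow> Var 0 * ?a - ?b = 0"
    using sp[of "- 1"]
    by (simp only: to_fract.hom_one to_fract.hom_uminus mult_1 mult_minus_left simp_thms
        add_uminus_conv_diff)
  moreover have "Var 0 * ?a + ?b = 0 \<and> Var 0 * ?a - ?b = 0 \<longleftrightarrow> ?a = 0 \<and> ?b = 0"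
  proof (intro iffI; elim conjE)
    assume *: "Var 0 * ?a + ?b = 0" "Var 0 * ?a - ?b = 0"
    have "2 * ?b = (Var 0 * ?a + ?b) - (Var 0 * ?a - ?b)" by simp
    hence "2 * ?b = 0" unfolding * by simp
    hence "?b = 0" by simp
    with * show "?a = 0 \<and> ?b = 0" by (simp add: Var_nonzero)
  qed simp
  ultimately show ?thesis using True by (auto simp: U_space_def)
qed (auto simp: U_space_def)

section \<open>Divisibility by the product of pair sums\<close>

text \<open>This is \<Delta>. Indexing by two-element sets instead of ordered pairs makes its
  symmetry a mere reindexing.\<close>

definition pair_sums :: "nat \<Rightarrow> cpoly" where
  "pair_sums N = (\<Prod>B | B \<subseteq> {1..N} \<and> card B = 2. \<Sum>i\<in>B. Var i)"

text \<open>Modulo \<open>d\<close>, the substitution agrees with the identity on the variables,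
  hence everywhere.\<close>

lemma dvd_diff_subst:
  assumes "\<And>i. d dvd Var i - \<sigma> i"
  shows "d dvd p - subst \<sigma> p"
proof (induction p rule: cpoly_induct)
  case (add p q)
  have "p + q - subst \<sigma> (p + q) = (p - subst \<sigma> p) + (q - subst \<sigma> q)"
    by (simp add: subst_add)
  thus ?case using dvd_add[OF add] by (simp only:)
next
  case (mult p q)
  have "p * q - subst \<sigma> (p * q) = p * (q - subst \<sigma> q) + (p - subst \<sigma> p) * subst \<sigma> q"
    by (simp add: subst_mult algebra_simps)
  thus ?case using mult by simp
qed (simp_all add: subst_Const subst_Var assms)

text \<open>The factor theorem for a linear form: this substitution changes \<open>p\<close> only by
  a multiple of \<open>Var i + Var j\<close>.\<close>

lemma add_dvd_if_subst_eq_0: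
  assumes "subst (Var(j := - Var i)) p = 0"
  shows "Var i + Var j dvd p"
  using dvd_diff_subst[of "Var i + Var j" "Var(j := - Var i)" p] assms by (simp add: add.commute)

text \<open>\<open>B\<close> has an element \<open>m\<close> outside \<open>{i, j}\<close>; setting
  its variable to 1 and all others to 0 gives the value 1.\<close>

lemma subst_pair_sum_nonzero:
  assumes "card B = 2" "B \<noteq> {i, j}" "i \<noteq> j"
  shows "subst (Var(j := - Var i)) (\<Sum>b\<in>B. Var b) \<noteq> 0"
proof
  assume "subst (Var(j := - Var i)) (\<Sum>b\<in>B. Var b) = 0" (is "?p = 0")
  have fin: "finite B" using assms(1) card.infinite by fastforce
  have "\<not> B \<subseteq> {i, j}"
    using assms card_subset_eq[of "{i, j}" B] by auto
  then obtain m where m: "m \<in> B" "m \<noteq> i" "m \<noteq> j" by blast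
  have "subst (\<lambda>a. if a = m then 1 else 0) ?p = (\<Sum>b\<in>B. if b = m then 1 else 0)"
    unfolding subst_comp subst.hom_sum subst_Var using m
    by (intro sum.cong) (auto simp: subst_Var subst.hom_uminus)
  also have "\<dots> = 1" using fin m by simp
  finally show False using \<open>?p = 0\<close> by simp
qed

text \<open>The factors are pairwise non-associated linear forms, so they can be split off one at a time:
  setting one of them to zero does not annihilate the others.\<close>

lemma prod_pair_sums_dvd:
  assumes "finite \<B>" "\<And>B. B \<in> \<B> \<Longrightarrow> card B = 2"
    and "\<And>i j. i \<noteq> j \<Longrightarrow> {i, j} \<in> \<B> \<Longrightarrow> subst (Var(j := - Var i)) p = 0"
  shows "(\<Prod>B\<in>\<B>. \<Sum>i\<in>B. Var i) dvd p"
  using assms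
proof (induction \<B>)
  case (insert B \<B>)
  have "(\<Prod>B\<in>\<B>. \<Sum>i\<in>B. Var i) dvd p" using insert by blast
  then obtain q where q: "p = (\<Prod>B\<in>\<B>. \<Sum>i\<in>B. Var i) * q" by (rule dvdE)
  obtain i j where ij: "B = {i, j}" "i \<noteq> j" using insert.prems(1)[of B] by (auto simp: card_2_iff)
  have "subst (Var(j := - Var i)) (\<Sum>b\<in>C. Var b) \<noteq> 0" if "C \<in> \<B>" for C
    using that insert ij by (intro subst_pair_sum_nonzero) auto
  moreover have "subst (Var(j := - Var i)) p = 0" using ij by (intro insert.prems(2)) auto
  ultimately have "subst (Var(j := - Var i)) q = 0"
    using insert.hyps(1) by (auto simp: q subst_mult subst.hom_prod)
  hence "(\<Sum>b\<in>B. Var b) dvd q" using add_dvd_if_subst_eq_0[of j i q] ij by simp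
  thus ?case using insert.hyps by (simp add: q mult.commute mult_dvd_mono)
qed simp

text \<open>By symmetry of \<open>p\<close>, vanishing at \<open>(x, -x)\<close> in the last two
  positions carries over to any two positions.\<close>

lemma subst_negate_eq_0_if_spec:
  assumes "n \<ge> 1" "p \<in> sym_polys (2 * n)" "subst (spec_subst n) p = 0"
    and ij: "i \<in> {1..2 * n}" "j \<in> {1..2 * n}" "i \<noteq> j"
  shows "subst (Var(j := - Var i)) p = 0"
proof -
  define \<tau> where "\<tau> = transpose (2 * n - 1) i"
  \<comment> \<open>\<open>\<tau>\<close> sends \<open>2 * n - 1\<close> to \<open>i\<close> and is
    its own inverse; exchanging \<open>2 * n\<close> with \<open>\<tau> j\<close> first also sends
    \<open>2 * n\<close> to \<open>j\<close>.\<close>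
  define \<pi> where "\<pi> = \<tau> \<circ> transpose (2 * n) (\<tau> j)"
  have \<tau>: "\<tau> permutes {1..2 * n}"
    unfolding \<tau>_def using assms(1) ij by (intro permutes_swap_id) auto
  have \<pi>: "\<pi> permutes {1..2 * n}"
    unfolding \<pi>_def using assms(1) ij permutes_in_image[OF \<tau>, of j]
    by (intro permutes_compose[OF _ \<tau>] permutes_swap_id) auto
  have "\<tau> j \<noteq> 2 * n - 1" using ij unfolding \<tau>_def by (auto simp: transpose_def split: if_splits)
  hence pi1: "\<pi> (2 * n - 1) = i" using assms(1) unfolding \<pi>_def by (auto simp: \<tau>_def transpose_def)
  have pi2: "\<pi> (2 * n) = j" unfolding \<pi>_def by (simp add: \<tau>_def)
  have pij: "\<pi> k = j \<longleftrightarrow> k = 2 * n" for k using permutes_inj[OF \<pi>] pi2 by (metis injD)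
  \<comment> \<open>The extra indeterminate \<open>Var 0\<close> of the specialization becomes the
    variable at position \<open>i\<close>.\<close>
  let ?\<rho> = "\<lambda>k. if k = 0 then Var i else Var (\<pi> k)"
  have "subst (Var(j := - Var i)) p = subst (Var(j := - Var i)) (subst (\<lambda>k. Var (\<pi> k)) p)"
    using assms(2) \<pi> by (simp add: sym_polys_def)
  also have "\<dots> = subst (\<lambda>k. subst ?\<rho> (spec_subst n k)) p"
    unfolding subst_comp
  proof (rule subst_cong)
    fix k assume "k \<in> vars p"
    hence "k \<in> {1..2 * n}" using assms(2) by (auto simp: sym_polys_def)
    thus "subst (Var(j := - Var i)) (Var (\<pi> k)) = subst ?\<rho> (spec_subst n k)"
      using assms(1) ij pi1 pi2 pij[of k]
      by (auto simp: subst_Var spec_subst_def subst.hom_uminus)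
  qed
  also have "\<dots> = subst ?\<rho> (subst (spec_subst n) p)" by (simp add: subst_comp)
  finally show ?thesis by (simp add: assms(3))
qed

lemma pair_sums_dvd:
  assumes "n \<ge> 1" "p \<in> sym_polys (2 * n)" "subst (spec_subst n) p = 0"
  shows "pair_sums (2 * n) dvd p"
  unfolding pair_sums_def
  by (rule prod_pair_sums_dvd) (auto intro!: subst_negate_eq_0_if_spec[OF assms])

lemma pair_sums_nonzero: "pair_sums N \<noteq> 0"
proof -
  have "(\<Sum>i\<in>B. Var i) \<noteq> 0" if "card B = 2" for B
  proof
    assume "(\<Sum>i\<in>B. Var i) = 0"
    hence "subst (\<lambda>_. 1) (\<Sum>i\<in>B. Var i) = 0" by simp
    thus False using that by (simp add: subst.hom_sum subst_Var)
  qed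
  thus ?thesis by (auto simp: pair_sums_def)
qed

lemma pair_sums_in_sym_polys: "pair_sums N \<in> sym_polys N"
  unfolding sym_polys_iff
proof (intro conjI allI impI)
  show "subst (\<lambda>i. if i \<in> {1..N} then Var i else 0) (pair_sums N) = pair_sums N"
    unfolding pair_sums_def subst.hom_prod subst.hom_sum subst_Var
    by (intro prod.cong sum.cong) auto
  fix \<pi> assume \<pi>: "\<pi> permutes {1..N}"
  have "subst (\<lambda>i. Var (\<pi> i)) (pair_sums N) =
      (\<Prod>B | B \<subseteq> {1..N} \<and> card B = 2. \<Sum>i\<in>\<pi> ` B. Var i)"
    unfolding pair_sums_def subst.hom_prod subst.hom_sum subst_Var
    by (simp add: sum.reindex[OF permutes_inj_on[OF \<pi>]])
  also have "\<dots> = (\<Prod>B | B \<subseteq> \<pi> ` {1..N} \<and> card B = 2. \<Sum>i\<in>B. Var i)"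
    by (rule prod.reindex_bij_betw[OF bij_betw_image_card[OF permutes_inj_on[OF \<pi>]]])
  also have "\<dots> = pair_sums N" unfolding permutes_image[OF \<pi>] pair_sums_def ..
  finally show "subst (\<lambda>i. Var (\<pi> i)) (pair_sums N) = pair_sums N" .
qed

text \<open>Each defining endomorphism fixes \<open>p\<close> and \<open>p * q\<close>; cancelling
  \<open>p\<close> in the domain shows that it fixes \<open>q\<close>.\<close>

lemma sym_polys_cancel:
  assumes "p * q \<in> sym_polys N" "p \<in> sym_polys N" "p \<noteq> 0"
  shows "q \<in> sym_polys N"
  using assms unfolding sym_polys_iff by (auto simp: subst_mult)

lemma sym_polys_quotient:
  assumes "n \<ge> 1" "p \<in> sym_polys (2 * n)" "subst (spec_subst n) p = 0"
  obtains q where "q \<in> sym_polys (2 * n)" "p = pair_sums (2 * n) * q"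
proof -
  obtain q where "p = pair_sums (2 * n) * q" using pair_sums_dvd[OF assms] by (rule dvdE)
  moreover from this have "q \<in> sym_polys (2 * n)"
    using assms(2) sym_polys_cancel pair_sums_in_sym_polys pair_sums_nonzero by blast
  ultimately show ?thesis using that by blast
qed

text \<open>The relations say that the transpose of the specialized matrix kills the vector of
  powers of \<open>x\<close>, which is nonzero, so over a domain the determinant vanishes.\<close>

lemma spec_det_eq_0:
  assumes "n \<ge> 1" "A \<in> carrier_mat n n" "\<And>k. k < n \<Longrightarrow> spec_sum n (\<lambda>s. A $$ (s, k)) = 0"
  shows "subst (spec_subst n) (det A) = 0"
proof -
  let ?A = "map_mat (subst (spec_subst n)) A"
  let ?b = "vec n (\<lambda>s. Var 0 ^ (2 * (n - 1 - s)))"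
  have car: "?A \<in> carrier_mat n n" using assms(2) by simp
  have "?A\<^sup>T *\<^sub>v ?b = 0\<^sub>v n"
    using assms(2) assms(3) by (intro eq_vecI)
      (auto simp: scalar_prod_def spec_sum_def atLeast0LessThan)
  moreover have "?b $ 0 \<noteq> 0\<^sub>v n $ 0" using assms(1) by (simp add: Var_nonzero)
  hence "?b \<noteq> 0\<^sub>v n" by metis
  ultimately have "det (?A\<^sup>T) = 0"
    using car by (subst det_0_iff_vec_prod_zero[of _ n]) (auto intro!: exI[of _ ?b])
  thus ?thesis by (simp add: det_transpose[OF car])
qed

section \<open>Homogeneity and comparison of degrees\<close>

text \<open>\<open>Var 0\<close>, which occurs in no member of \<open>sym_polys\<close>, is the
  scaling factor. Stated as an equation of substitutions, homogeneity passes directly to sums and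
  products.\<close>

definition homogeneous :: "nat \<Rightarrow> cpoly \<Rightarrow> bool" where
  "homogeneous d p \<longleftrightarrow> subst (\<lambda>i. Var i * Var 0) p = Var 0 ^ d * p"

lemma homogeneous_Var: "homogeneous 1 (Var i)"
  by (simp add: homogeneous_def subst_Var mult.commute)

lemma homogeneous_diff: "homogeneous d p \<Longrightarrow> homogeneous d q \<Longrightarrow> homogeneous d (p - q)"
  by (simp add: homogeneous_def subst.hom_minus right_diff_distrib)

lemma homogeneous_mult: "homogeneous d p \<Longrightarrow> homogeneous e q \<Longrightarrow> homogeneous (d + e) (p * q)"
  by (simp add: homogeneous_def subst_mult power_add mult_ac)

lemma homogeneous_sum: "(\<And>i. i \<in> I \<Longrightarrow> homogeneous d (f i)) \<Longrightarrow> homogeneous d (sum f I)"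
  by (simp add: homogeneous_def subst.hom_sum sum_distrib_left)

lemma homogeneous_prod:
  "(\<And>i. i \<in> I \<Longrightarrow> homogeneous (d i) (f i)) \<Longrightarrow> homogeneous (sum d I) (prod f I)"
  by (simp add: homogeneous_def subst.hom_prod power_sum prod.distrib)

text \<open>For negative \<open>k\<close> the polynomial is 0, so truncation by \<open>nat\<close>
  is harmless.\<close>

lemma homogeneous_elem_sym: "homogeneous (nat k) (elem_sym N k)"
  unfolding elem_sym_def
proof (rule homogeneous_sum)
  fix A assume "A \<in> {A. A \<subseteq> {1..N} \<and> int (card A) = k}"
  hence "nat k = (\<Sum>i\<in>A. 1)" by auto
  thus "homogeneous (nat k) (\<Prod>i\<in>A. Var i)"
    using homogeneous_prod[of A "\<lambda>_. 1" Var] homogeneous_Var by simp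
qed

text \<open>Both indices count from 0 here. In the recursion the shifted term trades one step of
  \<open>r\<close> for one of \<open>s\<close>; the other term has degree \<open>2 * (s + 1)\<close>
  plus \<open>2 * r + 1\<close>.\<close>

lemma homogeneous_P_sym: "homogeneous (2 * (r + s) + 1) (P_sym n (Suc r) (int s + 1))"
proof (induction r arbitrary: s)
  case 0
  have "nat (2 * (int s + 1) - 1) = 2 * (0 + s) + 1" by simp
  thus ?case using homogeneous_elem_sym[of "2 * (int s + 1) - 1" "2 * n"] by (simp only: P_sym.simps)
next
  case (Suc r)
  have "homogeneous (2 * (Suc r + s) + 1) (P_sym n (Suc r) (int s + 1 + 1))"
    using Suc[of "Suc s"] by (simp add: add_ac)
  moreover have "homogeneous (2 * (Suc r + s) + 1) (elem_sym (2 * n) (2 * (int s + 1)) * P_sym n (Suc r) 1)"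
    using homogeneous_mult[OF homogeneous_elem_sym[of "2 * (int s + 1)" "2 * n"] Suc[of 0]]
    by (simp add: nat_add_distrib nat_mult_distrib algebra_simps)
  ultimately show ?case by (simp add: homogeneous_diff)
qed

lemma homogeneous_pair_sums: "homogeneous (N choose 2) (pair_sums N)"
proof -
  have "homogeneous (\<Sum>B | B \<subseteq> {1..N} \<and> card B = 2. 1) (pair_sums N)"
    unfolding pair_sums_def by (intro homogeneous_prod homogeneous_sum homogeneous_Var)
  thus ?thesis using n_subsets[of "{1..N}" 2] by simp
qed

text \<open>Equal degrees make \<open>q\<close> invariant under scaling. Setting the scaling factor
  \<open>Var 0\<close> to 0, which does not affect \<open>q\<close> itself, then reduces
  \<open>q\<close> to its constant term.\<close>

lemma homogeneous_quotient_const: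
  assumes "homogeneous d p" "homogeneous d (p * q)" "p \<noteq> 0" "q \<in> sym_polys N"
  obtains c where "q = Const c"
proof -
  let ?\<kappa> = "\<lambda>i. if i \<in> {1..N} then Var i else 0"
  have const: "\<exists>c. subst (\<lambda>_. 0) r = Const c" for r
    by (induction r rule: cpoly_induct) (auto simp: subst_Const subst_Var subst_add subst_mult
        simp flip: Const_hom)
  have "subst (\<lambda>i. Var i * Var 0) q = q"
    using assms(1-3) by (simp add: homogeneous_def subst_mult Var_nonzero)
  hence "subst ?\<kappa> q = subst ?\<kappa> (subst (\<lambda>i. Var i * Var 0) q)" by simp
  also have "\<dots> = subst (\<lambda>_. 0) q" by (simp add: subst_comp subst_mult subst_Var)
  finally show ?thesis using that const[of q] assms(4) by (auto simp: sym_polys_iff)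
qed

section \<open>The determinant of the coefficient matrix\<close>

lemma det_in_sym_polys:
  assumes "A \<in> carrier_mat n n" "\<And>i j. i < n \<Longrightarrow> j < n \<Longrightarrow> A $$ (i, j) \<in> sym_polys N"
  shows "det A \<in> sym_polys N"
proof -
  have "subst \<sigma> (det A) = det A"
    if "\<And>i j. i < n \<Longrightarrow> j < n \<Longrightarrow> subst \<sigma> (A $$ (i, j)) = A $$ (i, j)" for \<sigma>
  proof -
    have "map_mat (subst \<sigma>) A = A" using assms(1) that by (intro eq_matI) auto
    thus ?thesis using subst.hom_det[of \<sigma> A] by simp
  qed
  thus ?thesis using assms(2) by (simp add: sym_polys_iff)
qed

text \<open>Division-free Cramer's rule: the replaced determinants are the entries of the adjugate
  applied to \<open>b\<close>.\<close>

lemma cramer_rule_entries: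
  fixes A :: "'a::comm_ring_1 mat"
  assumes A: "A \<in> carrier_mat n n" and b: "b \<in> carrier_vec n" and i: "i < n"
  shows "(\<Sum>k<n. A $$ (i, k) * det (replace_col A b k)) = det A * b $ i"
proof -
  have col: "det (replace_col A b k) = (adj_mat A *\<^sub>v b) $ k" if k: "k < n" for k
  proof -
    have B: "replace_col A b k \<in> carrier_mat n n" using A by (simp add: replace_col_def)
    \<comment> \<open>Minors along column \<open>k\<close> do not see the replaced column, so the
      cofactors are those of \<open>A\<close>.\<close>
    have "mat_delete (replace_col A b k) j k = mat_delete A j k" for j
      using A by (intro eq_matI) (auto simp: mat_delete_def replace_col_def)
    hence "det (replace_col A b k) = (\<Sum>j<n. b $ j * cofactor A j k)"
      unfolding laplace_expansion_column[OF B k] using A k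
      by (intro sum.cong) (auto simp: cofactor_def replace_col_def)
    also have "\<dots> = (adj_mat A *\<^sub>v b) $ k"
      using A b k by (simp add: adj_mat_def scalar_prod_def atLeast0LessThan mult.commute)
    finally show ?thesis .
  qed
  have "(\<Sum>k<n. A $$ (i, k) * det (replace_col A b k)) = (A *\<^sub>v (adj_mat A *\<^sub>v b)) $ i"
    using A b i adj_mat(1)[OF A] by (simp add: col scalar_prod_def atLeast0LessThan)
  also have "A *\<^sub>v (adj_mat A *\<^sub>v b) = (A * adj_mat A) *\<^sub>v b"
    using assoc_mult_mat_vec[OF A adj_mat(1)[OF A] b] by simp
  also have "\<dots> $ i = (\<Sum>j<n. det A * (if j = i then 1 else 0) * b $ j)"
    using b i by (auto simp: adj_mat(2)[OF A] scalar_prod_def atLeast0LessThan intro!: sum.cong)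
  also have "\<dots> = (\<Sum>j<n. if j = i then det A * b $ i else 0)"
    by (intro sum.cong) auto
  finally show ?thesis using i by simp
qed

text \<open>The column with index \<open>r\<close> holds the coefficients of
  \<open>v_vec n (r + 1)\<close>, so applying the matrix to a vector forms a linear combination of
  the \<open>v_vec\<close>.\<close>

definition P_mat :: "nat \<Rightarrow> cpoly mat" where
  "P_mat n = mat n n (\<lambda>(s, r). P_sym n (Suc r) (int s + 1))"

lemma P_mat_carrier: "P_mat n \<in> carrier_mat n n"
  by (simp add: P_mat_def)

text \<open>Entry \<open>(i, j)\<close> has degree \<open>2 * (i + j) + 1\<close>, so each
  permutation term has degree \<open>2 n (n - 1) + n\<close>, independently of the
  permutation.\<close>

lemma homogeneous_det_P_mat: "homogeneous (2 * n choose 2) (det (P_mat n))"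
  unfolding det_def'[OF P_mat_carrier]
proof (rule homogeneous_sum)
  fix p assume "p \<in> {p. p permutes {0..<n}}"
  hence p: "p permutes {0..<n}" by simp
  have "homogeneous (\<Sum>i = 0..<n. 2 * (p i + i) + 1) (\<Prod>i = 0..<n. P_mat n $$ (i, p i))"
  proof (rule homogeneous_prod)
    fix i assume i: "i \<in> {0..<n}"
    hence "p i < n" using permutes_in_image[OF p] by simp
    thus "homogeneous (2 * (p i + i) + 1) (P_mat n $$ (i, p i))"
      using i homogeneous_P_sym[of "p i" i n] by (simp add: P_mat_def)
  qed
  moreover have "(\<Sum>i = 0..<n. 2 * (p i + i) + 1) = 2 * n choose 2"
  proof -
    have "(\<Sum>i = 0..<n. 2 * (p i + i) + 1) = 2 * (\<Sum>i = 0..<n. p i) + 2 * (\<Sum>i = 0..<n. i) + n"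
      by (simp only: sum.distrib sum_distrib_left[symmetric] add_mult_distrib2) simp
    also have "(\<Sum>i = 0..<n. p i) = (\<Sum>i = 0..<n. i)"
      using sum.permute[OF p, of "\<lambda>i. i"] by (simp add: comp_def)
    also have "2 * (\<Sum>i = 0..<n. i) = n * (n - 1)"
      by (induction n) (auto simp: algebra_simps diff_mult_distrib2 elim!: Nat.le_imp_diff_is_add)
    finally show ?thesis
      by (cases n) (simp_all add: choose_two algebra_simps)
  qed
  moreover have "homogeneous 0 (signof p)"
    by (simp add: homogeneous_def subst.hom_signof)
  ultimately show "homogeneous (2 * n choose 2) (signof p * (\<Prod>i = 0..<n. P_mat n $$ (i, p i)))"
    using homogeneous_mult by fastforce
qed

section \<open>Vieta's formulas and nonvanishing of the determinant\<close>

lemma coeff_prod_linear: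
  assumes "finite S"
  shows "coeff (\<Prod>i\<in>S. [:f i, 1:]) j = esym f S (int (card S) - int j)"
  using assms
proof (induction S arbitrary: j)
  case empty
  show ?case by (cases j) (simp_all add: esym_0 esym_negative)
next
  case (insert a S)
  show ?case
    using insert by (cases j)
      (simp_all add: esym_insert mult_pCons_left esym_gt_card algebra_simps)
qed

text \<open>Over the complex numbers \<open>p\<close> splits into linear factors, and by Vieta its
  negated roots take the required values.\<close>

lemma exists_esym_values:
  fixes p :: "complex poly"
  assumes "monic p" "degree p = N"
  obtains y where "\<And>k. esym y {1..N} k = (if 0 \<le> k \<and> k \<le> int N then coeff p (N - nat k) else 0)"
proof -
  obtain as where as: "(\<Prod>a\<leftarrow>as. [:- a, 1:]) = p" "length as = N"
    using fundamental_theorem_algebra_factorized[of p] assms by auto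
  define y where "y i = - (as ! (i - 1))" for i
  have "(\<Prod>i\<in>{1..N}. [:y i, 1:]) = (\<Prod>i\<in>{0..<N}. [:- (as ! i), 1:])"
    by (rule prod.reindex_bij_witness[of _ Suc "\<lambda>i. i - 1"]) (auto simp: y_def)
  also have "\<dots> = p" unfolding as(1)[symmetric] by (simp add: prod.list_conv_set_nth as(2))
  finally have p: "(\<Prod>i\<in>{1..N}. [:y i, 1:]) = p" .
  have "esym y {1..N} k = (if 0 \<le> k \<and> k \<le> int N then coeff p (N - nat k) else 0)" for k
    using coeff_prod_linear[of "{1..N}" y "N - nat k"]
    by (auto simp: p esym_negative esym_gt_card of_nat_diff nat_le_iff simp del: One_nat_def)
  thus ?thesis using that by blast
qed

text \<open>Take for the \<open>x\<^sub>i\<close> the negated roots of \<open>X\<^bsup>2n\<^esup> + X\<close>. Then all \<open>e\<^sub>k\<close> vanish except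
  \<open>e\<^sub>0 = e\<^bsub>2n-1\<^esub> = 1\<close>, and the matrix becomes the antidiagonal permutation matrix.\<close>

lemma det_P_mat_nonzero:
  assumes "n \<ge> 1"
  shows "det (P_mat n) \<noteq> 0"
proof
  assume det0: "det (P_mat n) = 0"
  let ?p = "monom 1 (2 * n) + monom 1 1 :: complex poly"
  have "degree ?p = 2 * n"
    using assms by (subst degree_add_eq_left) (auto simp: degree_monom_eq)
  moreover from this have "monic ?p" using assms by simp
  ultimately obtain y :: "nat \<Rightarrow> complex" where y:
    "\<And>k. esym y {1..2 * n} k = (if 0 \<le> k \<and> k \<le> int (2 * n) then coeff ?p (2 * n - nat k) else 0)"
    using exists_esym_values by blast
  let ?ev = "subst (\<lambda>i. Const (y i))"
  have ev: "?ev (elem_sym (2 * n) k) = (if k = 0 \<or> k = 2 * int n - 1 then 1 else 0)" for k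
  proof -
    have "?ev (elem_sym (2 * n) k) = Const (esym y {1..2 * n} k)"
      by (simp add: elem_sym_eq_esym subst.hom_esym Const.hom_esym subst_Var)
    also have "esym y {1..2 * n} k = (if k = 0 \<or> k = 2 * int n - 1 then 1 else 0)"
    proof (cases "0 \<le> k \<and> k \<le> int (2 * n)")
      case True
      define m where "m = nat k"
      have m: "k = int m" "m \<le> 2 * n" using True by (simp_all add: m_def nat_le_iff)
      have "2 * n = 2 * n - m \<longleftrightarrow> k = 0" "1 = 2 * n - m \<longleftrightarrow> k = 2 * int n - 1"
        using m(2) assms unfolding m(1) by presburger+
      moreover have "k = 0 \<Longrightarrow> k \<noteq> 2 * int n - 1" by presburger
      ultimately show ?thesis unfolding y using True m(1) by simp
    next
      case False
      thus ?thesis unfolding y using assms by (simp only: if_False) auto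
    qed
    finally show ?thesis by (simp add: Const_hom)
  qed
  \<comment> \<open>All positive even-indexed \<open>e\<close> evaluate to 0, so the recursion
    reduces to the pure shift in \<open>s\<close>.\<close>
  have evP: "?ev (P_sym n (Suc r) (int s + 1)) = (if s + r + 1 = n then 1 else 0)" for r s
  proof (induction r arbitrary: s)
    case 0
    show ?case by (auto simp: ev)
  next
    case (Suc r)
    have "\<not> (2 * (int s + 1) = 0 \<or> 2 * (int s + 1) = 2 * int n - 1)" by presburger
    hence "?ev (elem_sym (2 * n) (2 * (int s + 1))) = 0" by (simp only: ev if_False)
    thus ?case using Suc[of "Suc s"] by (simp add: subst.hom_minus subst_mult add_ac)
  qed
  let ?M = "map_mat ?ev (P_mat n)"
  have M: "?M \<in> carrier_mat n n" using P_mat_carrier by simp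
  \<comment> \<open>The antidiagonal matrix is an involution; squaring it avoids computing the sign
    of the permutation.\<close>
  have "?M * ?M = 1\<^sub>m n"
  proof (rule eq_matI)
    fix i j assume "i < dim_row (1\<^sub>m n :: cpoly mat)" "j < dim_col (1\<^sub>m n :: cpoly mat)"
    hence ij: "i < n" "j < n" by simp_all
    have "(?M * ?M) $$ (i, j) = (\<Sum>k<n. ?M $$ (i, k) * ?M $$ (k, j))"
      using ij M by (simp add: scalar_prod_def atLeast0LessThan)
    also have "\<dots> = (\<Sum>k<n. if k = n - 1 - i then (if i = j then 1 else 0) else 0)"
      using ij by (intro sum.cong) (auto simp: P_mat_def evP)
    also have "\<dots> = 1\<^sub>m n $$ (i, j)" using ij by simp
    finally show "(?M * ?M) $$ (i, j) = 1\<^sub>m n $$ (i, j)" .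
  qed (use M in auto)
  hence "det ?M * det ?M = 1" using det_mult[OF M M] by simp
  thus False by (simp add: det0)
qed

lemma det_P_mat:
  assumes "n \<ge> 1"
  obtains c where "c \<noteq> 0" "det (P_mat n) = Const c * pair_sums (2 * n)"
proof -
  have entries: "i < n \<Longrightarrow> j < n \<Longrightarrow> P_mat n $$ (i, j) \<in> sym_polys (2 * n)" for i j
    by (simp add: P_mat_def P_sym_in_sym_polys)
  have "det (P_mat n) \<in> sym_polys (2 * n)"
    by (rule det_in_sym_polys[OF P_mat_carrier entries])
  moreover have "subst (spec_subst n) (det (P_mat n)) = 0"
    using spec_sum_P_sym[OF assms]
    by (intro spec_det_eq_0[OF assms P_mat_carrier]) (simp add: P_mat_def spec_sum_def)
  ultimately obtain q where q: "q \<in> sym_polys (2 * n)" "det (P_mat n) = pair_sums (2 * n) * q"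
    by (rule sym_polys_quotient[OF assms])
  obtain c where c: "q = Const c"
    using homogeneous_quotient_const[OF homogeneous_pair_sums _ pair_sums_nonzero q(1)]
      homogeneous_det_P_mat[of n] unfolding q(2) by blast
  show ?thesis
    using det_P_mat_nonzero[OF assms] that[of c] by (auto simp: q(2) c mult.commute Const_eq_0_iff)
qed

text \<open>Replacing a column by \<open>a\<close> keeps the relation in every column, so each
  Cramer numerator is \<Delta> times a symmetric polynomial. As the determinant is a constant times
  \<Delta>, the factor \<Delta> cancels.\<close>

lemma P_mat_solution:
  assumes "n \<ge> 1" "\<And>s. s < n \<Longrightarrow> a s \<in> sym_polys (2 * n)" "spec_sum n a = 0"
  obtains c where "\<And>r. c r \<in> sym_polys (2 * n)"
    "\<And>s. s < n \<Longrightarrow> a s = (\<Sum>r<n. c r * P_sym n (Suc r) (int s + 1))"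
proof -
  let ?A = "P_mat n" and ?a = "vec n a"
  note A = P_mat_carrier[of n]
  obtain \<gamma> where \<gamma>: "\<gamma> \<noteq> 0" "det ?A = Const \<gamma> * pair_sums (2 * n)" using det_P_mat[OF assms(1)] .
  have "\<exists>q\<in>sym_polys (2 * n). det (replace_col ?A ?a k) = pair_sums (2 * n) * q" if "k < n" for k
  proof -
    have B: "replace_col ?A ?a k \<in> carrier_mat n n" using A by (simp add: replace_col_def)
    have "det (replace_col ?A ?a k) \<in> sym_polys (2 * n)"
      using assms(2) A by (intro det_in_sym_polys[OF B])
        (auto simp: replace_col_def P_mat_def P_sym_in_sym_polys)
    moreover have "subst (spec_subst n) (det (replace_col ?A ?a k)) = 0"
    proof (rule spec_det_eq_0[OF assms(1) B])
      fix j assume "j < n"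
      thus "spec_sum n (\<lambda>s. replace_col ?A ?a k $$ (s, j)) = 0"
        using assms(3) spec_sum_P_sym[OF assms(1), of "Suc j"]
        by (cases "j = k") (simp_all add: replace_col_def P_mat_def spec_sum_def)
    qed
    ultimately show ?thesis by (metis sym_polys_quotient[OF assms(1)])
  qed
  then obtain q where q: "\<And>k. k < n \<Longrightarrow> q k \<in> sym_polys (2 * n)"
    "\<And>k. k < n \<Longrightarrow> det (replace_col ?A ?a k) = pair_sums (2 * n) * q k" by metis
  \<comment> \<open>The default 0 keeps \<open>c r\<close> symmetric at every index.\<close>
  define c where "c r = (if r < n then Const (inverse \<gamma>) * q r else 0)" for r
  have "c r \<in> sym_polys (2 * n)" for r
    using q(1)[of r] Const_in_sym_polys[of _ "2 * n"] is_subring_sym_polys[of "2 * n"]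
    by (simp add: c_def is_subring_def)
  moreover have "a s = (\<Sum>r<n. c r * P_sym n (Suc r) (int s + 1))" if s: "s < n" for s
  proof -
    have "(\<Sum>r<n. ?A $$ (s, r) * det (replace_col ?A ?a r)) = det ?A * a s"
      using cramer_rule_entries[OF A, of ?a s] s by simp
    hence "pair_sums (2 * n) * (\<Sum>r<n. ?A $$ (s, r) * q r) = pair_sums (2 * n) * (Const \<gamma> * a s)"
      unfolding \<gamma>(2) by (simp add: q(2) sum_distrib_left mult_ac)
    hence "(\<Sum>r<n. ?A $$ (s, r) * q r) = Const \<gamma> * a s"
      using pair_sums_nonzero by simp
    hence "Const (inverse \<gamma>) * (\<Sum>r<n. ?A $$ (s, r) * q r) = Const (inverse \<gamma>) * Const \<gamma> * a s"
      by simp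
    also have "Const (inverse \<gamma>) * Const \<gamma> = 1" using \<gamma>(1) by (simp flip: Const_hom)
    finally show ?thesis
      using s by (simp add: sum_distrib_left c_def P_mat_def mult_ac)
  qed
  ultimately show ?thesis by (rule that)
qed

text \<open>A nonzero determinant over a domain excludes kernel vectors, even with coefficients that
  are not symmetric.\<close>

lemma P_mat_kernel:
  assumes "n \<ge> 1" "\<And>s. s < n \<Longrightarrow> (\<Sum>r<n. c r * P_sym n (Suc r) (int s + 1)) = 0" "r < n"
  shows "c r = 0"
proof (rule ccontr)
  assume "c r \<noteq> 0"
  hence "vec n c $ r \<noteq> 0\<^sub>v n $ r" using assms(3) by simp
  hence "vec n c \<noteq> 0\<^sub>v n" by metis
  moreover have "P_mat n *\<^sub>v vec n c = 0\<^sub>v n"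
    using assms(2) by (intro eq_vecI) (auto simp: P_mat_def scalar_prod_def atLeast0LessThan mult.commute)
  ultimately have "det (P_mat n) = 0"
    by (subst det_0_iff_vec_prod_zero[OF P_mat_carrier]) (auto intro!: exI[of _ "vec n c"])
  thus False using det_P_mat_nonzero[OF assms(1)] by simp
qed

section \<open>Bases of free modules\<close>

text \<open>Passes from an indexed family to the set-based notions of basis. Independence is assumed
  for all coefficients in the ring, so differences of coefficient families can be taken
  freely.\<close>

lemma free_basis_family:
  fixes b :: "'i \<Rightarrow> 'a::comm_ring_1 poly"
  assumes S: "is_subring S" and I: "finite I"
    and M: "M = {\<Sum>i\<in>I. Polynomial.smult (c i) (b i) | c. \<forall>i\<in>I. c i \<in> S}"
    and indep: "\<And>c. (\<Sum>i\<in>I. Polynomial.smult (c i) (b i)) = 0 \<Longrightarrow> \<forall>i\<in>I. c i = 0"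
  shows "is_free_basis S M (b ` I)"
    and "card (b ` I) = card I"
    and "is_direct_sum M I (\<lambda>i. cyclic_submodule S (b i))"
proof -
  have S0: "0 \<in> S" and S1: "1 \<in> S" and S_add: "\<And>x y. x \<in> S \<Longrightarrow> y \<in> S \<Longrightarrow> x + y \<in> S"
    and S_mult: "\<And>x y. x \<in> S \<Longrightarrow> y \<in> S \<Longrightarrow> x * y \<in> S"
    using S by (auto simp: is_subring_def)
  have unit: "b j = (\<Sum>i\<in>I. Polynomial.smult (if i = j then 1 else 0) (b i))" if "j \<in> I" for j
    using I that by (simp add: if_distrib[of "\<lambda>x. Polynomial.smult x _"] cong: if_cong)
  have uniq: "\<forall>i\<in>I. c i = d i"
    if "(\<Sum>i\<in>I. Polynomial.smult (c i) (b i)) = (\<Sum>i\<in>I. Polynomial.smult (d i) (b i))" for c d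
    using indep[of "\<lambda>i. c i - d i"] that by (simp add: smult_diff_left sum_subtractf)
  \<comment> \<open>A repeated member would have two different unit coefficient families.\<close>
  have inj: "inj_on b I"
  proof (rule inj_onI)
    fix j k assume jk: "j \<in> I" "k \<in> I" "b j = b k"
    have "\<forall>i\<in>I. (if i = j then 1 else 0 :: 'a) = (if i = k then 1 else 0)"
      by (rule uniq) (simp only: unit[OF jk(1), symmetric] unit[OF jk(2), symmetric] jk(3))
    with jk(1) have "(if j = j then 1 else 0 :: 'a) = (if j = k then 1 else 0)" by (rule bspec[rotated])
    thus "j = k" by (simp split: if_splits)
  qed
  show "card (b ` I) = card I" using inj by (rule card_image)
  \<comment> \<open>Padding with zero coefficients turns a sum over a subset of the basis into one
    over \<open>I\<close>.\<close>
  have expand: "(\<Sum>x\<in>A. Polynomial.smult (c x) x) = (\<Sum>i\<in>I. Polynomial.smult (if b i \<in> A then c (b i) else 0) (b i))"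
    if "A \<subseteq> b ` I" for A c
  proof -
    have "(\<Sum>x\<in>A. Polynomial.smult (c x) x) = (\<Sum>x\<in>b ` I. Polynomial.smult (if x \<in> A then c x else 0) x)"
      using that I by (intro sum.mono_neutral_cong_left) auto
    thus ?thesis by (simp add: sum.reindex[OF inj])
  qed
  have submod: "is_submodule S M"
    unfolding is_submodule_def
  proof (intro conjI ballI)
    show "0 \<in> M" unfolding M using S0 by (intro CollectI exI[of _ "\<lambda>_. 0"]) simp
  next
    fix x y assume "x \<in> M" "y \<in> M"
    then obtain c d where "x = (\<Sum>i\<in>I. Polynomial.smult (c i) (b i))" "\<forall>i\<in>I. c i \<in> S"
      "y = (\<Sum>i\<in>I. Polynomial.smult (d i) (b i))" "\<forall>i\<in>I. d i \<in> S" unfolding M by blast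
    thus "x + y \<in> M" unfolding M
      by (intro CollectI exI[of _ "\<lambda>i. c i + d i"]) (simp add: S_add smult_add_left sum.distrib)
  next
    fix a x assume "a \<in> S" "x \<in> M"
    then obtain c where "x = (\<Sum>i\<in>I. Polynomial.smult (c i) (b i))" "\<forall>i\<in>I. c i \<in> S" unfolding M by blast
    thus "Polynomial.smult a x \<in> M" unfolding M using \<open>a \<in> S\<close>
      by (intro CollectI exI[of _ "\<lambda>i. a * c i"]) (simp add: S_mult smult_sum2)
  qed
  have "b ` I \<subseteq> M"
  proof
    fix x assume "x \<in> b ` I"
    then obtain j where "j \<in> I" "x = b j" by blast
    thus "x \<in> M" unfolding M using unit[of j] S0 S1
      by (intro CollectI exI[of _ "\<lambda>i. if i = j then 1 else 0"]) simp
  qed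
  moreover have "span_over S (b ` I) = M"
  proof (intro equalityI subsetI)
    fix x assume "x \<in> span_over S (b ` I)"
    then obtain A c where A: "A \<subseteq> b ` I" "c ` A \<subseteq> S" "x = (\<Sum>y\<in>A. Polynomial.smult (c y) y)"
      unfolding span_over_def by blast
    thus "x \<in> M" unfolding M expand[OF A(1)] using S0
      by (intro CollectI exI[of _ "\<lambda>i. if b i \<in> A then c (b i) else 0"]) auto
  next
    fix x assume "x \<in> M"
    then obtain c where c: "x = (\<Sum>i\<in>I. Polynomial.smult (c i) (b i))" "\<forall>i\<in>I. c i \<in> S" unfolding M by blast
    hence "x = (\<Sum>y\<in>b ` I. Polynomial.smult (c (the_inv_into I b y)) y)"
      by (simp add: sum.reindex[OF inj] the_inv_into_f_f[OF inj])
    moreover have "(\<lambda>y. c (the_inv_into I b y)) ` b ` I \<subseteq> S"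
      using c(2) by (auto simp: the_inv_into_f_f[OF inj])
    ultimately show "x \<in> span_over S (b ` I)"
      unfolding span_over_def using I
      by (intro CollectI exI[of _ "b ` I"] exI[of _ "\<lambda>y. c (the_inv_into I b y)"] conjI) simp_all
  qed
  moreover have "independent_over S (b ` I)"
    unfolding independent_over_def
  proof (intro allI impI ballI; elim conjE)
    fix A c x
    assume A: "A \<subseteq> b ` I" and 0: "(\<Sum>y\<in>A. Polynomial.smult (c y) y) = 0" and x: "x \<in> A"
    obtain i where i: "i \<in> I" "x = b i" using A x by blast
    have "\<forall>i\<in>I. (if b i \<in> A then c (b i) else 0) = 0"
      using 0 unfolding expand[OF A] by (rule indep)
    with i x show "c x = 0" by auto
  qed
  ultimately show "is_free_basis S M (b ` I)" using submod by (simp add: is_free_basis_def)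
  show "is_direct_sum M I (\<lambda>i. cyclic_submodule S (b i))"
    unfolding is_direct_sum_def
  proof (intro conjI allI impI)
    show "M = {sum f I | f. \<forall>i\<in>I. f i \<in> cyclic_submodule S (b i)}"
    proof (intro equalityI subsetI)
      fix x assume "x \<in> M"
      then obtain c where "x = (\<Sum>i\<in>I. Polynomial.smult (c i) (b i))" "\<forall>i\<in>I. c i \<in> S" unfolding M by blast
      thus "x \<in> {sum f I | f. \<forall>i\<in>I. f i \<in> cyclic_submodule S (b i)}"
        by (intro CollectI exI[of _ "\<lambda>i. Polynomial.smult (c i) (b i)"]) (auto simp: cyclic_submodule_def)
    next
      fix x assume "x \<in> {sum f I | f. \<forall>i\<in>I. f i \<in> cyclic_submodule S (b i)}"
      then obtain f where f: "x = sum f I" "\<forall>i\<in>I. \<exists>a. f i = Polynomial.smult a (b i) \<and> a \<in> S"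
        by (auto simp: cyclic_submodule_def)
      from f(2) obtain c where "\<forall>i\<in>I. c i \<in> S \<and> f i = Polynomial.smult (c i) (b i)" by metis
      thus "x \<in> M" unfolding M f(1) by (intro CollectI exI[of _ c]) simp
    qed
  next
    fix f g
    assume "(\<forall>i\<in>I. f i \<in> cyclic_submodule S (b i) \<and> g i \<in> cyclic_submodule S (b i)) \<and> sum f I = sum g I"
    hence fg: "\<forall>i\<in>I. \<exists>a. f i = Polynomial.smult a (b i)" "\<forall>i\<in>I. \<exists>a. g i = Polynomial.smult a (b i)" "sum f I = sum g I"
      by (auto simp: cyclic_submodule_def)
    from fg(1) obtain c where c: "\<forall>i\<in>I. f i = Polynomial.smult (c i) (b i)" by metis
    from fg(2) obtain d where d: "\<forall>i\<in>I. g i = Polynomial.smult (d i) (b i)" by metis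
    have "\<forall>i\<in>I. c i = d i" using fg(3) c d by (intro uniq) simp
    thus "\<forall>i\<in>I. f i = g i" using c d by simp
  qed
qed

section \<open>Coefficients of combinations of the basis vectors\<close>

lemma poly_eqI_even_odd:
  assumes "\<And>s. coeff p (2 * s) = coeff q (2 * s)" "\<And>s. coeff p (2 * s + 1) = coeff q (2 * s + 1)"
  shows "p = q"
proof (rule poly_eqI)
  fix k show "coeff p k = coeff q k"
    by (cases "even k") (auto elim!: evenE oddE simp: assms assms(2)[simplified])
qed

lemma coeff_v_vec:
  "coeff (v_vec n r) (2 * s) = (if s < n then P_sym n r (int s + 1) else 0)"
  "coeff (v_vec n r) (2 * s + 1) = 0"
proof -
  have "coeff (v_vec n r) (2 * s) = (\<Sum>t = 1..n. if t = s + 1 then P_sym n r (int t) else 0)"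
    unfolding v_vec_def coeff_sum by (intro sum.cong) auto
  thus "coeff (v_vec n r) (2 * s) = (if s < n then P_sym n r (int s + 1) else 0)"
    by (simp add: add.commute Suc_le_eq)
  show "coeff (v_vec n r) (2 * s + 1) = 0"
    unfolding v_vec_def coeff_sum coeff_monom by (intro sum.neutral ballI if_not_P) presburger
qed

lemma coeff_w_vec:
  "coeff (w_vec n r) (2 * s) = 0"
  "coeff (w_vec n r) (2 * s + 1) = (if s < n then P_sym n r (int s + 1) else 0)"
proof -
  show "coeff (w_vec n r) (2 * s) = 0"
  proof (cases s)
    case (Suc t)
    thus ?thesis using coeff_v_vec(2)[of n r t] by (simp add: w_vec_def coeff_monom_mult)
  qed (simp add: w_vec_def coeff_monom_mult)
  show "coeff (w_vec n r) (2 * s + 1) = (if s < n then P_sym n r (int s + 1) else 0)"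
    by (simp add: w_vec_def coeff_monom_mult coeff_v_vec(1))
qed

definition vw_sum :: "nat \<Rightarrow> (nat \<Rightarrow> cpoly) \<Rightarrow> (nat \<Rightarrow> cpoly) \<Rightarrow> cpoly poly" where
  "vw_sum n c d = (\<Sum>r=1..n. Polynomial.smult (c r) (v_vec n r)) + (\<Sum>r=1..n. Polynomial.smult (d r) (w_vec n r))"

text \<open>The even and odd coefficients are given by two independent systems, both with matrix
  \<open>P_mat n\<close>.\<close>

lemma coeff_vw_sum:
  "coeff (vw_sum n c d) (2 * s) =
     (if s < n then \<Sum>r<n. c (Suc r) * P_sym n (Suc r) (int s + 1) else 0)"
  "coeff (vw_sum n c d) (2 * s + 1) =
     (if s < n then \<Sum>r<n. d (Suc r) * P_sym n (Suc r) (int s + 1) else 0)"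
  unfolding vw_sum_def coeff_add coeff_sum coeff_smult coeff_v_vec coeff_w_vec
  by (simp_all add: sum.atLeast1_atMost_eq)

lemma spec_sum_combination:
  assumes "n \<ge> 1"
  shows "spec_sum n (\<lambda>s. if s < n then \<Sum>r<n. c r * P_sym n (Suc r) (int s + 1) else 0) = 0"
proof -
  have "spec_sum n (\<lambda>s. if s < n then \<Sum>r<n. c r * P_sym n (Suc r) (int s + 1) else 0) =
      (\<Sum>r<n. subst (spec_subst n) (c r) * spec_sum n (\<lambda>s. P_sym n (Suc r) (int s + 1)))"
    unfolding spec_sum_def sum_distrib_left
    by (subst sum.swap) (simp add: subst.hom_sum subst_mult sum_distrib_right mult.assoc)
  thus ?thesis by (simp add: spec_sum_P_sym[OF assms])
qed

lemma vw_sum_in_U_space: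
  assumes "n \<ge> 1" "\<And>r. r \<in> {1..n} \<Longrightarrow> c r \<in> sym_polys (2 * n)" "\<And>r. r \<in> {1..n} \<Longrightarrow> d r \<in> sym_polys (2 * n)"
  shows "vw_sum n c d \<in> U_space n"
proof -
  let ?S = "sym_polys (2 * n)"
  note S = is_subring_sym_polys[of "2 * n"]
  have S0: "0 \<in> ?S" and S_mult: "\<And>x y. x \<in> ?S \<Longrightarrow> y \<in> ?S \<Longrightarrow> x * y \<in> ?S"
    using S by (auto simp: is_subring_def)
  have sums: "(\<Sum>r<n. f (Suc r) * P_sym n (Suc r) (int s + 1)) \<in> ?S"
    if "\<And>r. r \<in> {1..n} \<Longrightarrow> f r \<in> ?S" for f s
    using that by (intro is_subring_closed(1)[OF S] S_mult P_sym_in_sym_polys) auto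
  have "coeff (vw_sum n c d) k \<in> ?S \<and> (k \<ge> 2 * n \<longrightarrow> coeff (vw_sum n c d) k = 0)" for k
  proof (cases "even k")
    case True
    then obtain s where "k = 2 * s" by (rule evenE)
    thus ?thesis using sums[of c s] assms(2) S0 by (simp add: coeff_vw_sum(1))
  next
    case False
    then obtain s where "k = 2 * s + 1" by (rule oddE)
    thus ?thesis using sums[of d s] assms(3) S0 by (simp only: coeff_vw_sum(2)) auto
  qed
  hence "vw_sum n c d \<in> H_space (2 * n)" by (simp add: H_space_def)
  thus ?thesis
    unfolding U_space_iff[OF assms(1)] coeff_vw_sum using spec_sum_combination[OF assms(1)] by simp
qed

lemma U_space_obtain_vw_sum:
  assumes "n \<ge> 1" "P \<in> U_space n"
  obtains c d where "\<And>r. c r \<in> sym_polys (2 * n)" "\<And>r. d r \<in> sym_polys (2 * n)" "P = vw_sum n c d"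
proof -
  have P: "P \<in> H_space (2 * n)" "spec_sum n (\<lambda>s. coeff P (2 * s)) = 0"
    "spec_sum n (\<lambda>s. coeff P (2 * s + 1)) = 0"
    using assms(2) unfolding U_space_iff[OF assms(1)] by blast+
  have sym: "coeff P k \<in> sym_polys (2 * n)" if "k < 2 * n" for k
    using P(1) that by (simp add: H_space_def)
  have high: "coeff P k = 0" if "k \<ge> 2 * n" for k
    using P(1) that by (simp add: H_space_def)
  have even: "coeff P (2 * s) \<in> sym_polys (2 * n)" if "s < n" for s using that by (intro sym) simp
  have odd: "coeff P (2 * s + 1) \<in> sym_polys (2 * n)" if "s < n" for s using that by (intro sym) simp
  obtain c where c: "\<And>r. c r \<in> sym_polys (2 * n)"
    "\<And>s. s < n \<Longrightarrow> coeff P (2 * s) = (\<Sum>r<n. c r * P_sym n (Suc r) (int s + 1))"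
    using P_mat_solution[OF assms(1) even P(2)] by blast
  obtain d where d: "\<And>r. d r \<in> sym_polys (2 * n)"
    "\<And>s. s < n \<Longrightarrow> coeff P (2 * s + 1) = (\<Sum>r<n. d r * P_sym n (Suc r) (int s + 1))"
    using P_mat_solution[OF assms(1) odd P(3)] by blast
  \<comment> \<open>\<open>P_mat_solution\<close> counts from 0, the basis vectors from 1.\<close>
  have "P = vw_sum n (\<lambda>r. c (r - 1)) (\<lambda>r. d (r - 1))"
    by (rule poly_eqI_even_odd; unfold coeff_vw_sum) (auto simp: c(2) d(2)[simplified] high)
  with c(1) d(1) show ?thesis by (rule that)
qed

lemma vw_sum_eq_0:
  assumes "n \<ge> 1" "vw_sum n c d = 0" "r \<in> {1..n}"
  shows "c r = 0" "d r = 0"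
proof -
  have r: "r - 1 < n" "Suc (r - 1) = r" using assms(3) by auto
  have "c (Suc (r - 1)) = 0"
  proof (rule P_mat_kernel[OF assms(1) _ r(1), of "\<lambda>r. c (Suc r)"])
    fix s assume "s < n"
    thus "(\<Sum>r<n. c (Suc r) * P_sym n (Suc r) (int s + 1)) = 0"
      using coeff_vw_sum(1)[of n c d s] by (simp add: assms(2))
  qed
  moreover have "d (Suc (r - 1)) = 0"
  proof (rule P_mat_kernel[OF assms(1) _ r(1), of "\<lambda>r. d (Suc r)"])
    fix s assume "s < n"
    thus "(\<Sum>r<n. d (Suc r) * P_sym n (Suc r) (int s + 1)) = 0"
      using coeff_vw_sum(2)[of n c d s] by (simp add: assms(2))
  qed
  ultimately show "c r = 0" "d r = 0" by (simp_all only: r(2))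
qed

theorem theorem3:
  fixes n :: nat
  assumes "n \<ge> 1"
  shows "is_free_basis (sym_polys (2 * n)) (U_space n)
           (v_vec n ` {1..n} \<union> w_vec n ` {1..n}) \<and>
         card (v_vec n ` {1..n} \<union> w_vec n ` {1..n}) = 2 * n \<and>
         is_direct_sum (U_space n) ({1..n} <+> {1..n})
           (case_sum (\<lambda>r. cyclic_submodule (sym_polys (2 * n)) (v_vec n r))
                     (\<lambda>r. cyclic_submodule (sym_polys (2 * n)) (w_vec n r)))"
proof -
  \<comment> \<open>The disjoint sum keeps the two families apart; that all \<open>2 * n\<close>
    vectors are distinct then follows from independence.\<close>
  let ?I = "{1..n} <+> {1..n}" and ?b = "case_sum (v_vec n) (w_vec n)" and ?S = "sym_polys (2 * n)"
  have sum: "(\<Sum>i\<in>?I. Polynomial.smult (c i) (?b i)) = vw_sum n (\<lambda>r. c (Inl r)) (\<lambda>r. c (Inr r))" for c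
    by (simp add: vw_sum_def sum.Plus)
  have M: "U_space n = {\<Sum>i\<in>?I. Polynomial.smult (c i) (?b i) | c. \<forall>i\<in>?I. c i \<in> ?S}"
  proof (intro equalityI subsetI)
    fix P assume "P \<in> U_space n"
    then obtain c d where "\<And>r. c r \<in> ?S" "\<And>r. d r \<in> ?S" "P = vw_sum n c d"
      using U_space_obtain_vw_sum[OF assms] by blast
    thus "P \<in> {\<Sum>i\<in>?I. Polynomial.smult (c i) (?b i) | c. \<forall>i\<in>?I. c i \<in> ?S}"
      unfolding sum by (intro CollectI exI[of _ "case_sum c d"]) auto
  next
    fix P assume "P \<in> {\<Sum>i\<in>?I. Polynomial.smult (c i) (?b i) | c. \<forall>i\<in>?I. c i \<in> ?S}"
    thus "P \<in> U_space n" unfolding sum by (auto intro!: vw_sum_in_U_space[OF assms])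
  qed
  have indep: "\<forall>i\<in>?I. c i = 0" if "(\<Sum>i\<in>?I. Polynomial.smult (c i) (?b i)) = 0" for c
    using vw_sum_eq_0[OF assms that[unfolded sum]] by auto
  have image: "?b ` ?I = v_vec n ` {1..n} \<union> w_vec n ` {1..n}"
    by (auto simp: Plus_def image_Un image_image)
  have cyclic: "(\<lambda>i. cyclic_submodule ?S (?b i)) =
      case_sum (\<lambda>r. cyclic_submodule ?S (v_vec n r)) (\<lambda>r. cyclic_submodule ?S (w_vec n r))"
    by (auto simp: fun_eq_iff split: sum.split)
  have "finite ?I" "card ?I = 2 * n" by (simp_all add: card_Plus)
  with free_basis_family[OF is_subring_sym_polys _ M indep] show ?thesis
    unfolding image cyclic by simp
qed

end
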